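(* The conjugate quandle $\mathrm{Conj}(\mathrm{SL}(2,\mathbb{C}))$ is decomposed into connected components as $$\mathrm{Conj}(\mathrm{SL}(2,\mathbb{C}))=\{I_2\}\sqcup\{-I_2\}\sqcup\Bigl(\bigsqcup_{t\in\mathbb{C}}\mathrm{Conj}(\widetilde{X}_t)\Bigr).$$ Each connected component $\mathrm{Conj}(\widetilde{X}_t)$ is (1) a $2$-dimensional complex submanifold of $\mathbb{C}^4$ that is homeomorphic to $\widetilde{H}_t\backslash\mathrm{SL}(2,\mathbb{C})$, and (2) a connected subquandle of $\mathrm{Conj}(\mathrm{SL}(2,\mathbb{C}))$ that is isomorphic to $Q(\mathrm{SL}(2,\mathbb{C}),\widetilde{H}_t,\widetilde{\sigma}_t)$.
   Context: A quandle is a non-empty set $X$ with a binary operation $\lhd$ such that $x\lhd x=x$; for every $y$ the map $s_y(x)=x\lhd y$ is a bijection of $X$; and $(x\lhd y)\lhd z=(x\lhd z)\lhd(y\lhd z)$. Isomorphisms are bijections preserving $\lhd$. The inner automorphism group of $X$ is the group of bijections generated by all $s_y$; a connected component of $X$ is one of its orbits, and $X$ is connected if it acts transitively. A subquandle is a subset that is a quandle under the restricted operation. For a group $G$, $\mathrm{Conj}(G)$ is $G$ with $x\lhd y=y^{-1}xy$; for a conjugation-closed subset $Y\subset G$, $\mathrm{Conj}(Y)$ is the corresponding subquandle. A quandle triplet $(G,H,\sigma)$ consists of a group $G$, an automorphism $\sigma$ of $G$ and a subgroup $H$ of $\{g\in G\mid\sigma(g)=g\}$; $Q(G,H,\sigma)$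 is the quandle $H\backslash G$ with $Hx\lhd Hy:=H\sigma(xy^{-1})y$. $\mathrm{SL}(2,\mathbb{C})$ is regarded as a subset of $\mathbb{C}^4$. For $t\in\mathbb{C}$: $\widetilde{X}_t=\{A\in\mathrm{SL}(2,\mathbb{C})\setminus\{\pm I_2\}\mid\operatorname{tr}A=t\}$ with the relative topology. Let $\lambda_t=e^{i\theta}$ if $t=2\cos\theta\in(-2,2)$, $\theta\in(-\pi,\pi)$ (either fixed choice of $\theta$); $\lambda_t=\varepsilon$ if $t=2\varepsilon$, $\varepsilon\in\{\pm1\}$; $\lambda_t=\lambda$ if $t=\lambda+\lambda^{-1}\in\mathbb{C}\setminus[-2,2]$ with $|\lambda|>1$. Let $A_t=\begin{pmatrix}\lambda_t&1\\0&\lambda_t^{-1}\end{pmatrix}$ if $t=\pm2$ and $A_t=\begin{pmatrix}\lambda_t&0\\0&\lambda_t^{-1}\end{pmatrix}$ otherwise. Let $\widetilde{H}_t=\left\{\begin{pmatrix}\varepsilon&\mu\\0&\varepsilon\end{pmatrix}\mid\varepsilon\in\{\pm1\},\mu\in\mathbb{C}\right\}$ if $t=\pm2$ and $\widetilde{H}_t=\left\{\begin{pmatrix}\mu&0\\0&\mu^{-1}\end{pmatrix}\mid\mu\in\mathbb{C}^*\right\}$ otherwise. Let $\widetilde{\sigma}_t(g)=A_t^{-1}gA_t$. The space $\widetilde H_t\backslash\mathrm{SL}(2,\mathbb C)$ of right cosets $\widetilde H_t g$ has the quotient topology. *)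

theory Defs
  imports "HOL-Analysis.Analysis" "HOL-Algebra.Generated_Groups" "HOL-Algebra.Group_Action"
begin

section \<open>Quandles\<close>

record 'a quandle_struct = "'a partial_object" +
  qop :: "'a \<Rightarrow> 'a \<Rightarrow> 'a" (infixl \<open>\<triangleleft>\<index>\<close> 70)

locale quandle =
  fixes X (structure)
  assumes nonempty: "carrier X \<noteq> {}"
    and closed: "\<lbrakk>x \<in> carrier X; y \<in> carrier X\<rbrakk> \<Longrightarrow> x \<triangleleft> y \<in> carrier X"
    and idem: "x \<in> carrier X \<Longrightarrow> x \<triangleleft> x = x"
    and bij: "y \<in> carrier X \<Longrightarrow> bij_betw (\<lambda>x. x \<triangleleft> y) (carrier X) (carrier X)"
    and self_distrib:
      "\<lbrakk>x \<in> carrier X; y \<in> carrier X; z \<in> carrier X\<rbrakk> \<Longrightarrow>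
        (x \<triangleleft> y) \<triangleleft> z = (x \<triangleleft> z) \<triangleleft> (y \<triangleleft> z)"

definition quandle_isomorphic ::
    "('a, 'm) quandle_struct_scheme \<Rightarrow> ('b, 'n) quandle_struct_scheme \<Rightarrow> bool" where
  "quandle_isomorphic X Y \<longleftrightarrow>
    (\<exists>f. bij_betw f (carrier X) (carrier Y) \<and>
      (\<forall>x\<in>carrier X. \<forall>y\<in>carrier X. f (x \<triangleleft>\<^bsub>X\<^esub> y) = f x \<triangleleft>\<^bsub>Y\<^esub> f y))"

definition subquandle :: "'a set \<Rightarrow> ('a, 'm) quandle_struct_scheme \<Rightarrow> bool" where
  "subquandle Y X \<longleftrightarrow> Y \<subseteq> carrier X \<and> quandle (X\<lparr>carrier := Y\<rparr>)"

text \<open>The maps \<open>s\<^sub>y\<close> are restricted to the carrier because \<^const>\<open>BijGroup\<close> consists of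
  extensional functions.\<close>

definition inner_aut_group :: "('a, 'm) quandle_struct_scheme \<Rightarrow> ('a \<Rightarrow> 'a) monoid" where
  "inner_aut_group X =
    (BijGroup (carrier X))\<lparr>carrier :=
      generate (BijGroup (carrier X))
        ((\<lambda>y. \<lambda>x\<in>carrier X. x \<triangleleft>\<^bsub>X\<^esub> y) ` carrier X)\<rparr>"

definition quandle_components :: "('a, 'm) quandle_struct_scheme \<Rightarrow> 'a set set" where
  "quandle_components X = orbits (inner_aut_group X) (carrier X) (\<lambda>f. f)"

definition connected_quandle :: "('a, 'm) quandle_struct_scheme \<Rightarrow> bool" where
  "connected_quandle X \<longleftrightarrow>
    quandle X \<and> transitive_action (inner_aut_group X) (carrier X) (\<lambda>f. f)"

definition Conj_on :: "('a, 'm) monoid_scheme \<Rightarrow> 'a set \<Rightarrow> 'a quandle_struct" where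
  "Conj_on G Y =
    \<lparr>carrier = Y, qop = (\<lambda>x y. inv\<^bsub>G\<^esub> y \<otimes>\<^bsub>G\<^esub> x \<otimes>\<^bsub>G\<^esub> y)\<rparr>"

abbreviation Conj :: "('a, 'm) monoid_scheme \<Rightarrow> 'a quandle_struct" where
  "Conj G \<equiv> Conj_on G (carrier G)"

lemma quandle_Conj:
  assumes "group G"
  shows "quandle (Conj G)"
proof -
  interpret group G by fact
  have c1: "inv\<^bsub>G\<^esub> a \<otimes>\<^bsub>G\<^esub> (a \<otimes>\<^bsub>G\<^esub> b) = b"
    and c2: "a \<otimes>\<^bsub>G\<^esub> (inv\<^bsub>G\<^esub> a \<otimes>\<^bsub>G\<^esub> b) = b"
    if "a \<in> carrier G" "b \<in> carrier G" for a b
    using that by (simp_all flip: m_assoc)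
  show ?thesis
  proof
    fix y assume y: "y \<in> carrier (Conj G)"
    show "bij_betw (\<lambda>x. x \<triangleleft>\<^bsub>Conj G\<^esub> y) (carrier (Conj G)) (carrier (Conj G))"
      by (rule bij_betwI[where g = "\<lambda>x. y \<otimes>\<^bsub>G\<^esub> x \<otimes>\<^bsub>G\<^esub> inv\<^bsub>G\<^esub> y"])
        (use y in \<open>auto simp: Conj_on_def m_assoc c1 c2\<close>)
  qed (auto simp: Conj_on_def m_assoc inv_mult_group c1 c2)
qed

locale quandle_triplet = group G for G (structure) and H and \<sigma> +
  assumes automorphism: "\<sigma> \<in> iso G G"
    and subgroup: "subgroup H G"
    and fixed: "H \<subseteq> {g \<in> carrier G. \<sigma> g = g}"

text \<open>For a quandle triplet all the cosets in the union are equal, so that the operation is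
  \<open>Hx \<triangleleft> Hy = H\<sigma>(xy\<inverse>)y\<close>; see \<open>qop_Q\<close> below.\<close>

definition Q :: "('a, 'm) monoid_scheme \<Rightarrow> 'a set \<Rightarrow> ('a \<Rightarrow> 'a) \<Rightarrow> 'a set quandle_struct" where
  "Q G H \<sigma> =
    \<lparr>carrier = rcosets\<^bsub>G\<^esub> H,
     qop = (\<lambda>C D. \<Union>x\<in>C. \<Union>y\<in>D. H #>\<^bsub>G\<^esub> (\<sigma> (x \<otimes>\<^bsub>G\<^esub> inv\<^bsub>G\<^esub> y) \<otimes>\<^bsub>G\<^esub> y))\<rparr>"

lemma (in quandle_triplet) qop_Q:
  assumes x: "x \<in> carrier G" and y: "y \<in> carrier G"
  shows "(H #> x) \<triangleleft>\<^bsub>Q G H \<sigma>\<^esub> (H #> y) = H #> (\<sigma> (x \<otimes> inv y) \<otimes> y)"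
proof -
  have hom: "\<sigma> (a \<otimes> b) = \<sigma> a \<otimes> \<sigma> b" if "a \<in> carrier G" "b \<in> carrier G" for a b
    using automorphism that by (auto simp: iso_def hom_def)
  have cl: "\<sigma> a \<in> carrier G" if "a \<in> carrier G" for a
    using automorphism that by (auto simp: iso_def hom_def)
  have HG: "h \<in> carrier G" and fxd: "\<sigma> h = h" if "h \<in> H" for h
    using fixed that by auto
  have *: "H #> (\<sigma> (a \<otimes> inv b) \<otimes> b) = H #> (\<sigma> (x \<otimes> inv y) \<otimes> y)"
    if ab: "a \<in> H #> x" "b \<in> H #> y" for a b
  proof -
    obtain h k where h: "h \<in> H" "a = h \<otimes> x" and k: "k \<in> H" "b = k \<otimes> y"
      using ab by (auto simp: r_coset_def)
    have hk: "inv k \<in> H" using k subgroup by (simp add: subgroup.m_inv_closed)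
    have "a \<otimes> inv b = h \<otimes> ((x \<otimes> inv y) \<otimes> inv k)"
      using h k x y HG by (simp add: inv_mult_group m_assoc)
    then have "\<sigma> (a \<otimes> inv b) = h \<otimes> (\<sigma> (x \<otimes> inv y) \<otimes> inv k)"
      using h hk x y HG fxd by (simp add: hom)
    moreover have "inv k \<otimes> (k \<otimes> y) = y"
      using HG[OF k(1)] y by (simp flip: m_assoc)
    ultimately have "\<sigma> (a \<otimes> inv b) \<otimes> b = h \<otimes> (\<sigma> (x \<otimes> inv y) \<otimes> y)"
      using h(1) hk k x y by (simp add: m_assoc HG cl)
    moreover have "H #> (h \<otimes> z) = H #> z" if "z \<in> carrier G" for z
      by (rule trans[OF coset_mult_assoc[OF subgroup.subset[OF subgroup] HG[OF h(1)] that, symmetric]])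
        (simp only: coset_join2[OF HG[OF h(1)] subgroup h(1)])
    moreover have "\<sigma> (x \<otimes> inv y) \<otimes> y \<in> carrier G" using x y cl by simp
    ultimately show ?thesis by metis
  qed
  have "x \<in> H #> x" "y \<in> H #> y"
    using x y subgroup by (auto intro: rcos_self)
  then have "(\<Union>a\<in>H #> x. \<Union>b\<in>H #> y. H #> (\<sigma> (a \<otimes> inv b) \<otimes> b))
      = H #> (\<sigma> (x \<otimes> inv y) \<otimes> y)"
    using * by blast
  then show ?thesis
    by (simp add: Q_def)
qed


section \<open>Topology and complex submanifolds\<close>

definition quotient_topology :: "'a topology \<Rightarrow> ('a \<Rightarrow> 'b) \<Rightarrow> 'b topology" where
  "quotient_topology X f =
    topology (\<lambda>U. U \<subseteq> f ` topspace X \<and> openin X {x \<in> topspace X. f x \<in> U})"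

lemma openin_quotient_topology:
  "openin (quotient_topology X f) U \<longleftrightarrow>
    U \<subseteq> f ` topspace X \<and> openin X {x \<in> topspace X. f x \<in> U}"
proof -
  have "istopology (\<lambda>U. U \<subseteq> f ` topspace X \<and> openin X {x \<in> topspace X. f x \<in> U})"
    unfolding istopology_def
  proof (intro conjI allI impI)
    fix S T
    assume "S \<subseteq> f ` topspace X \<and> openin X {x \<in> topspace X. f x \<in> S}"
      "T \<subseteq> f ` topspace X \<and> openin X {x \<in> topspace X. f x \<in> T}"
    moreover have "{x \<in> topspace X. f x \<in> S \<inter> T} =
        {x \<in> topspace X. f x \<in> S} \<inter> {x \<in> topspace X. f x \<in> T}" by auto
    ultimately show "S \<inter> T \<subseteq> f ` topspace X" "openin X {x \<in> topspace X. f x \<in> S \<inter> T}"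
      by auto
  next
    fix K
    assume K: "\<forall>S\<in>K. S \<subseteq> f ` topspace X \<and> openin X {x \<in> topspace X. f x \<in> S}"
    then show "\<Union>K \<subseteq> f ` topspace X" by auto
    have "{x \<in> topspace X. f x \<in> \<Union>K} = (\<Union>S\<in>K. {x \<in> topspace X. f x \<in> S})" by auto
    with K show "openin X {x \<in> topspace X. f x \<in> \<Union>K}" by auto
  qed
  then show ?thesis
    unfolding quotient_topology_def by (simp add: topology_inverse')
qed

text \<open>Holomorphic maps of several variables: real Frechet differentiable with
  \<open>\<complex>\<close>-linear derivative.\<close>

definition holomorphic_map_on ::
    "(complex^'n \<Rightarrow> complex^'m) \<Rightarrow> (complex^'n) set \<Rightarrow> bool" where
  "holomorphic_map_on f U \<longleftrightarrow>
    (\<forall>z\<in>U. \<exists>D. (f has_derivative D) (at z) \<and> (\<forall>c v. D (c *s v) = c *s D v))"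

text \<open>Embedded submanifolds: around every point there is a biholomorphic chart \<open>\<phi> : U \<rightarrow> V\<close> of
  the ambient space that takes \<open>M \<inter> U\<close> to the intersection of \<open>V\<close> with a \<open>d\<close>-dimensional
  coordinate subspace.\<close>

definition complex_submanifold :: "nat \<Rightarrow> (complex^'n) set \<Rightarrow> bool" where
  "complex_submanifold d M \<longleftrightarrow>
    (\<forall>p\<in>M. \<exists>U V (\<phi> :: complex^'n \<Rightarrow> complex^'n) \<psi> J.
      open U \<and> p \<in> U \<and> open V \<and>
      homeomorphism U V \<phi> \<psi> \<and> holomorphic_map_on \<phi> U \<and> holomorphic_map_on \<psi> V \<and>
      card J = d \<and> \<phi> ` (M \<inter> U) = {w \<in> V. \<forall>i. i \<notin> J \<longrightarrow> w $ i = 0})"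


section \<open>The special linear group\<close>

abbreviation mat22 :: "complex \<Rightarrow> complex \<Rightarrow> complex \<Rightarrow> complex \<Rightarrow> complex^2^2" where
  "mat22 a b c d \<equiv> vector [vector [a, b], vector [c, d]]"

definition SL2 :: "(complex^2^2) monoid" where
  "SL2 = \<lparr>carrier = {A. det A = 1}, mult = (**), one = mat 1\<rparr>"

lemma group_SL2: "group SL2"
proof (rule groupI)
  fix A assume "A \<in> carrier SL2"
  then have A: "det A = 1" by (simp add: SL2_def)
  then obtain B where B: "B ** A = mat 1"
    by (metis invertible_det_nz invertible_def zero_neq_one)
  then have "det B = 1" using A by (metis det_I det_mul mult.right_neutral)
  with B show "\<exists>B\<in>carrier SL2. B \<otimes>\<^bsub>SL2\<^esub> A = \<one>\<^bsub>SL2\<^esub>"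
    by (auto simp: SL2_def)
qed (auto simp: SL2_def det_mul matrix_mul_assoc)

definition flatten :: "complex^2^2 \<Rightarrow> complex^4" where
  "flatten A = vector [A $ 1 $ 1, A $ 1 $ 2, A $ 2 $ 1, A $ 2 $ 2]"

text \<open>The topology of \<open>SL(2,\<complex>)\<close> as a subset of \<open>\<complex>\<^sup>4\<close>.\<close>

definition SL2_topology :: "(complex^2^2) topology" where
  "SL2_topology = pullback_topology (carrier SL2) flatten euclidean"

definition X_tilde :: "complex \<Rightarrow> (complex^2^2) set" where
  "X_tilde t = {A \<in> carrier SL2 - {mat 1, - mat 1}. trace A = t}"

text \<open>The relation between \<open>t\<close> and \<open>\<lambda>\<^sub>t\<close>. It leaves two values for \<open>\<lambda>\<^sub>t\<close> (from \<open>\<plusminus>\<theta>\<close>)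
  if \<open>t \<in> (-2,2)\<close> and determines \<open>\<lambda>\<^sub>t\<close> otherwise.\<close>

definition is_lambda :: "complex \<Rightarrow> complex \<Rightarrow> bool" where
  "is_lambda t l \<longleftrightarrow>
    (\<exists>\<theta>::real. -pi < \<theta> \<and> \<theta> < pi \<and> -2 < 2 * cos \<theta> \<and> 2 * cos \<theta> < 2 \<and>
      t = complex_of_real (2 * cos \<theta>) \<and> l = cis \<theta>) \<or>
    (\<exists>\<epsilon>\<in>{1, -1}. t = 2 * \<epsilon> \<and> l = \<epsilon>) \<or>
    (t \<notin> complex_of_real ` {-2..2} \<and> l \<noteq> 0 \<and> t = l + inverse l \<and> 1 < cmod l)"

lemma ex_is_lambda: "\<exists>l. is_lambda t l"
proof (cases "t \<in> complex_of_real ` {-2..2}")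
  case True
  then obtain r where r: "t = complex_of_real r" "-2 \<le> r" "r \<le> 2" by auto
  consider "r = 2" | "r = -2" | "-2 < r" "r < 2" using r by linarith
  then show ?thesis
  proof cases
    case 3
    then have "cos (arccos (r/2)) = r/2" "0 < arccos (r/2)" "arccos (r/2) < pi"
      by (auto simp: arccos_lt_bounded)
    then show ?thesis using 3 r unfolding is_lambda_def
      by (intro exI[of _ "cis (arccos (r/2))"] disjI1 exI[of _ "arccos (r/2)"]) auto
  qed (use r in \<open>auto simp: is_lambda_def\<close>)
next
  case False
  define s where "s = csqrt (t\<^sup>2 - 4)"
  have s: "s\<^sup>2 = t\<^sup>2 - 4" by (simp add: s_def)
  define l where "l = (t + s) / 2"
  have q: "l * (t - l) = 1" using s unfolding l_def by (simp add: field_simps power2_eq_square)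
  then have l0: "l \<noteq> 0" and il: "inverse l = t - l"
    by (auto simp: inverse_unique)
  have "cmod l \<noteq> 1"
  proof
    assume l1: "cmod l = 1"
    then have "inverse l = cnj l" by (simp add: inverse_unique complex_norm_square[symmetric])
    then have "t = complex_of_real (2 * Re l)" using il by (simp add: complex_eq_iff)
    moreover have "\<bar>Re l\<bar> \<le> 1" using l1 abs_Re_le_cmod[of l] by simp
    ultimately show False using False by (metis (no_types, lifting) abs_le_iff atLeastAtMost_iff
      image_eqI mult_left_mono mult.right_neutral mult_minus_right minus_le_iff zero_le_numeral)
  qed
  then consider "1 < cmod l" | "1 < cmod (inverse l)" using l0
    by (metis linorder_neqE_linordered_idom norm_inverse one_less_inverse zero_less_norm_iff)
  then show ?thesis
  proof cases
    case 1 then show ?thesis using False l0 il by (auto simp: is_lambda_def intro!: exI[of _ l])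
  next
    case 2
    have "t = inverse l + inverse (inverse l)" by (subst inverse_inverse_eq) (subst il, simp)
    with 2 False l0 have "is_lambda t (inverse l)"
      unfolding is_lambda_def using nonzero_imp_inverse_nonzero by blast
    then show ?thesis ..
  qed
qed

text \<open>In the next two definitions \<open>l\<close> stands for \<open>\<lambda>\<^sub>t\<close>.\<close>

definition A_mat :: "complex \<Rightarrow> complex \<Rightarrow> complex^2^2" where
  "A_mat t l = (if t = 2 \<or> t = -2 then mat22 l 1 0 (inverse l) else mat22 l 0 0 (inverse l))"

definition sigma_tilde :: "complex \<Rightarrow> complex \<Rightarrow> complex^2^2 \<Rightarrow> complex^2^2" where
  "sigma_tilde t l g = inv\<^bsub>SL2\<^esub> (A_mat t l) \<otimes>\<^bsub>SL2\<^esub> g \<otimes>\<^bsub>SL2\<^esub> A_mat t l"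

definition H_tilde :: "complex \<Rightarrow> (complex^2^2) set" where
  "H_tilde t =
    (if t = 2 \<or> t = -2 then {mat22 \<epsilon> \<mu> 0 \<epsilon> | \<epsilon> \<mu>. \<epsilon> \<in> {1, -1}}
     else {mat22 \<mu> 0 0 (inverse \<mu>) | \<mu>. \<mu> \<noteq> 0})"

end

theory Submission
  imports Defs
begin

text \<open>Conjugacy classes are homogeneous: for a representative \<open>A\<close> the map \<open>g \<mapsto> g\<inverse>Ag\<close> identifies the
  cosets of the centralizer of \<open>A\<close> with the class, and it turns the operation of the coset quandle
  for the inner automorphism of \<open>A\<close> into conjugation. A non-scalar matrix \<open>B\<close> of determinant \<open>1\<close> and
  trace \<open>t\<close> has a row vector \<open>v\<close> such that \<open>v, vB\<close> is a basis, in which \<open>B\<close> becomes the companion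
  matrix of its characteristic polynomial; hence these matrices form one class. Since \<open>v\<close> can be
  kept fixed near \<open>B\<close>, this also yields continuous local sections of the orbit map, which is
  therefore a quotient map. A class other than \<open>{I}\<close> and \<open>{-I}\<close> contains triangular matrices whose quotients are
  all transvections, so it generates \<open>SL(2,\<complex>)\<close> and is connected as a quandle in its own right.\<close>

subsection \<open>Conjugation quandles of groups\<close>

lemma (in group) inv_mult_cancel [simp]:
  assumes "a \<in> carrier G" "b \<in> carrier G"
  shows "inv a \<otimes> (a \<otimes> b) = b" "a \<otimes> (inv a \<otimes> b) = b"
  using assms by (simp_all flip: m_assoc)

text \<open>The form \<open>g x g^-1\<close> is a left action, hence a homomorphism into
  \<open>BijGroup Y\<close>; the symmetry \<open>s_y\<close> of the conjugation quandle is its value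
  at \<open>inv y\<close>.\<close>

definition conj_act :: "('a, 'm) monoid_scheme \<Rightarrow> 'a set \<Rightarrow> 'a \<Rightarrow> 'a \<Rightarrow> 'a" where
  "conj_act G Y g = (\<lambda>x\<in>Y. g \<otimes>\<^bsub>G\<^esub> x \<otimes>\<^bsub>G\<^esub> inv\<^bsub>G\<^esub> g)"

locale conj_closed = group G for G (structure) and Y +
  assumes sub: "Y \<subseteq> carrier G"
    and conj_cl: "\<lbrakk>x \<in> Y; g \<in> carrier G\<rbrakk> \<Longrightarrow> g \<otimes> x \<otimes> inv g \<in> Y"
begin

lemma conj_cl': "\<lbrakk>x \<in> Y; g \<in> carrier G\<rbrakk> \<Longrightarrow> inv g \<otimes> x \<otimes> g \<in> Y"
  using conj_cl[of x "inv g"] by simp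

lemma in_carrier [simp]: "x \<in> Y \<Longrightarrow> x \<in> carrier G"
  using sub by blast

lemma conj_cl_assoc:
  assumes "x \<in> Y" "g \<in> carrier G"
  shows "g \<otimes> (x \<otimes> inv g) \<in> Y" "inv g \<otimes> (x \<otimes> g) \<in> Y"
  using conj_cl[OF assms] conj_cl'[OF assms] assms by (simp_all add: m_assoc)

lemma conj_act_Bij: "g \<in> carrier G \<Longrightarrow> conj_act G Y g \<in> Bij Y"
  unfolding Bij_def conj_act_def
  by (auto intro!: bij_betwI[where g = "\<lambda>x. inv g \<otimes> x \<otimes> g"] conj_cl conj_cl' simp: m_assoc)

sublocale action: group_hom G "BijGroup Y" "conj_act G Y"
proof (intro group_hom.intro group_hom_axioms.intro is_group group_BijGroup)
  show "conj_act G Y \<in> hom G (BijGroup Y)"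
  proof (rule homI)
    fix g h assume gh: "g \<in> carrier G" "h \<in> carrier G"
    have "conj_act G Y (g \<otimes> h) = compose Y (conj_act G Y g) (conj_act G Y h)"
      using gh by (auto simp: conj_act_def compose_def inv_mult_group m_assoc conj_cl_assoc)
    then show "conj_act G Y (g \<otimes> h) = conj_act G Y g \<otimes>\<^bsub>BijGroup Y\<^esub> conj_act G Y h"
      using gh by (simp add: BijGroup_def conj_act_Bij)
  qed (simp add: BijGroup_def conj_act_Bij)
qed

lemma quandle_Conj_on:
  assumes "Y \<noteq> {}"
  shows "quandle (Conj_on G Y)"
proof
  fix y assume y: "y \<in> carrier (Conj_on G Y)"
  show "bij_betw (\<lambda>x. x \<triangleleft>\<^bsub>Conj_on G Y\<^esub> y) (carrier (Conj_on G Y)) (carrier (Conj_on G Y))"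
    by (rule bij_betwI[where g = "\<lambda>x. y \<otimes> x \<otimes> inv y"])
      (use y in \<open>auto simp: Conj_on_def m_assoc conj_cl_assoc\<close>)
qed (use assms in \<open>auto simp: Conj_on_def m_assoc inv_mult_group conj_cl_assoc\<close>)

text \<open>Each \<open>s_y\<close> is the action of \<open>inv y\<close>, and a homomorphism maps a
  generated subgroup onto the subgroup generated by the image.\<close>

lemma carrier_inner_aut_Conj_on:
  "carrier (inner_aut_group (Conj_on G Y)) = conj_act G Y ` generate G (m_inv G ` Y)"
proof -
  have "(\<lambda>y. \<lambda>x\<in>Y. inv y \<otimes> x \<otimes> y) ` Y = conj_act G Y ` m_inv G ` Y"
    by (auto simp: conj_act_def image_image intro!: image_cong)
  then show ?thesis
    using action.generate_img[of "m_inv G ` Y"] sub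
    by (simp add: inner_aut_group_def Conj_on_def image_subset_iff)
qed

lemma group_action_inner_aut: "group_action (inner_aut_group (Conj_on G Y)) Y (\<lambda>f. f)"
proof -
  have sg: "subgroup (carrier (inner_aut_group (Conj_on G Y))) (BijGroup Y)"
    unfolding carrier_inner_aut_Conj_on
    by (intro action.subgroup_img_is_subgroup generate_is_subgroup) auto
  have eq: "inner_aut_group (Conj_on G Y)
      = (BijGroup Y)\<lparr>carrier := carrier (inner_aut_group (Conj_on G Y))\<rparr>"
    by (simp add: inner_aut_group_def Conj_on_def)
  have "group_hom ((BijGroup Y)\<lparr>carrier := carrier (inner_aut_group (Conj_on G Y))\<rparr>)
      (BijGroup Y) (\<lambda>f. f)"
    by (rule action.H.canonical_inj_is_hom[OF sg, unfolded id_def])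
  then show ?thesis
    unfolding group_action_def using eq by simp
qed

lemma orbit_inner_aut:
  assumes "x \<in> Y"
  shows "orbit (inner_aut_group (Conj_on G Y)) (\<lambda>f. f) x
    = {g \<otimes> x \<otimes> inv g |g. g \<in> generate G (m_inv G ` Y)}"
proof -
  have "conj_act G Y g x = g \<otimes> x \<otimes> inv g" for g
    using assms by (simp add: conj_act_def)
  then show ?thesis
    unfolding orbit_def carrier_inner_aut_Conj_on Setcompr_eq_image by (simp add: image_image)
qed

text \<open>The inner automorphisms of \<open>Y\<close> come only from the subgroup that
  \<open>Y\<close> generates, so conjugacy in \<open>G\<close> alone need not give transitivity;
  \<open>gen\<close> closes this gap.\<close>

lemma connected_Conj_on:
  assumes gen: "generate G Y = carrier G"
    and x0: "x0 \<in> Y" and trans: "\<And>y. y \<in> Y \<Longrightarrow> \<exists>g\<in>carrier G. y = g \<otimes> x0 \<otimes> inv g"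
  shows "connected_quandle (Conj_on G Y)"
proof -
  interpret act: group_action "inner_aut_group (Conj_on G Y)" Y "\<lambda>f. f"
    by (rule group_action_inner_aut)
  \<comment> \<open>Inverting twice shows that the inverses generate at least what \<open>Y\<close>
    does, hence all of \<open>G\<close>.\<close>
  have "Y \<subseteq> generate G (m_inv G ` Y)"
  proof
    fix y assume "y \<in> Y"
    then show "y \<in> generate G (m_inv G ` Y)"
      using generate.inv[of "inv y" "m_inv G ` Y" G] by simp
  qed
  moreover have inv_sub: "m_inv G ` Y \<subseteq> carrier G"
    by auto
  ultimately have "generate G (m_inv G ` Y) = carrier G"
    using generate_subgroup_incl[OF _ generate_is_subgroup[OF inv_sub], of Y]
      generate_incl[OF inv_sub] by (simp add: gen)
  then have orb: "orbit (inner_aut_group (Conj_on G Y)) (\<lambda>f. f) x0 = Y"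
    using trans conj_cl[OF x0] unfolding orbit_inner_aut[OF x0] by auto
  have "transitive_action (inner_aut_group (Conj_on G Y)) Y (\<lambda>f. f)"
  proof
    fix x y assume xy: "x \<in> Y" "y \<in> Y"
    then have "y \<in> orbit (inner_aut_group (Conj_on G Y)) (\<lambda>f. f) x"
      using act.orbit_trans[of x x0 y] act.orbit_sym[of x0 x] x0 orb by simp
    then show "\<exists>g\<in>carrier (inner_aut_group (Conj_on G Y)). g x = y"
      by (auto simp: orbit_def)
  qed
  then show ?thesis
    unfolding connected_quandle_def using quandle_Conj_on x0 by (auto simp: Conj_on_def)
qed

end

text \<open>The inverses of all elements exhaust the group, so every conjugation is inner and the
  components are the conjugacy classes.\<close>

lemma (in group) quandle_components_Conj:
  "quandle_components (Conj G) = (\<lambda>x. {g \<otimes> x \<otimes> inv g |g. g \<in> carrier G}) ` carrier G"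
proof -
  interpret conj_closed G "carrier G" by unfold_locales auto
  have "m_inv G ` carrier G = carrier G"
    by (force intro!: image_eqI[where x = "inv _"])
  then have "generate G (m_inv G ` carrier G) = carrier G"
    using generate_incl generate.incl by fastforce
  then show ?thesis
    unfolding quandle_components_def orbits_def Setcompr_eq_image
    by (intro image_cong) (simp_all add: orbit_inner_aut Setcompr_eq_image, simp add: Conj_on_def)
qed

section \<open>Centralizers and coset quandles\<close>

lemma (in group) subgroup_centralizer:
  assumes a: "a \<in> carrier G"
  shows "subgroup {h \<in> carrier G. h \<otimes> a = a \<otimes> h} G"
proof (rule subgroupI)
  fix h k
  assume "h \<in> {h \<in> carrier G. h \<otimes> a = a \<otimes> h}" "k \<in> {h \<in> carrier G. h \<otimes> a = a \<otimes> h}"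
  then have h: "h \<in> carrier G" "h \<otimes> a = a \<otimes> h" and k: "k \<in> carrier G" "k \<otimes> a = a \<otimes> k"
    by auto
  have "h \<otimes> k \<otimes> a = a \<otimes> (h \<otimes> k)"
    using h k a by (metis m_assoc)
  then show "h \<otimes> k \<in> {h \<in> carrier G. h \<otimes> a = a \<otimes> h}" using h k by simp
  have "inv h \<otimes> a = inv h \<otimes> (a \<otimes> h) \<otimes> inv h"
    using h(1) a by (simp add: m_assoc)
  also have "\<dots> = a \<otimes> inv h"
    unfolding h(2)[symmetric] using h(1) a by simp
  finally show "inv h \<in> {h \<in> carrier G. h \<otimes> a = a \<otimes> h}" using h by simp
qed (use a in auto)

text \<open>Both sides say that \<open>k g^-1\<close> commutes with \<open>a\<close>.\<close>

lemma (in group) conj_eq_iff_same_coset: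
  assumes a: "a \<in> carrier G" and H_def: "H = {h \<in> carrier G. h \<otimes> a = a \<otimes> h}"
    and g: "g \<in> carrier G" and k: "k \<in> carrier G"
  shows "inv g \<otimes> a \<otimes> g = inv k \<otimes> a \<otimes> k \<longleftrightarrow> H #> g = H #> k"
proof -
  have H: "subgroup H G"
    unfolding H_def by (rule subgroup_centralizer[OF a])
  have "H #> g = H #> k \<longleftrightarrow> k \<otimes> inv g \<in> H"
  proof
    have HG: "H \<subseteq> carrier G" by (rule subgroup.subset[OF H])
    have kg: "k \<otimes> inv g \<in> carrier G" using g k by simp
    show "k \<otimes> inv g \<in> H" if "H #> g = H #> k"
      using coset_join1[OF coset_mult_inv2[OF that[symmetric] k g HG] kg H] .
    show "H #> g = H #> k" if "k \<otimes> inv g \<in> H"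
      using coset_mult_inv1[OF coset_join2[OF kg H that] k g HG] by simp
  qed
  also have "\<dots> \<longleftrightarrow> k \<otimes> inv g \<otimes> a = a \<otimes> (k \<otimes> inv g)"
    using g k by (simp add: H_def)
  also have "\<dots> \<longleftrightarrow> inv g \<otimes> a \<otimes> g = inv k \<otimes> a \<otimes> k"
  proof
    assume eq: "k \<otimes> inv g \<otimes> a = a \<otimes> (k \<otimes> inv g)"
    have "inv g \<otimes> a \<otimes> g = inv k \<otimes> (k \<otimes> inv g \<otimes> a) \<otimes> g"
      using g k a by (simp add: m_assoc)
    also have "\<dots> = inv k \<otimes> a \<otimes> k"
      unfolding eq using g k a by (simp add: m_assoc)
    finally show "inv g \<otimes> a \<otimes> g = inv k \<otimes> a \<otimes> k" .
  next
    assume eq: "inv g \<otimes> a \<otimes> g = inv k \<otimes> a \<otimes> k"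
    have "k \<otimes> inv g \<otimes> a = k \<otimes> (inv g \<otimes> a \<otimes> g) \<otimes> inv g"
      using g k a by (simp add: m_assoc)
    also have "\<dots> = a \<otimes> (k \<otimes> inv g)"
      unfolding eq using g k a by (simp add: m_assoc)
    finally show "k \<otimes> inv g \<otimes> a = a \<otimes> (k \<otimes> inv g)" .
  qed
  finally show ?thesis by blast
qed

lemma (in group) quandle_triplet_centralizer:
  assumes a: "a \<in> carrier G" and H_def: "H = {h \<in> carrier G. h \<otimes> a = a \<otimes> h}"
  shows "quandle_triplet G H (\<lambda>g. inv a \<otimes> g \<otimes> a)"
proof (intro quandle_triplet.intro quandle_triplet_axioms.intro is_group)
  show "(\<lambda>g. inv a \<otimes> g \<otimes> a) \<in> iso G G"
    unfolding iso_def
  proof (intro CollectI conjI)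
    show "bij_betw (\<lambda>g. inv a \<otimes> g \<otimes> a) (carrier G) (carrier G)"
      by (rule bij_betwI[where g = "\<lambda>x. a \<otimes> x \<otimes> inv a"]) (use a in \<open>auto simp: m_assoc\<close>)
  qed (use a in \<open>auto intro!: homI simp: m_assoc\<close>)
  show "subgroup H G"
    unfolding H_def by (rule subgroup_centralizer[OF a])
  show "H \<subseteq> {g \<in> carrier G. inv a \<otimes> g \<otimes> a = g}"
  proof
    fix h assume "h \<in> H"
    then have h: "h \<in> carrier G" "h \<otimes> a = a \<otimes> h"
      by (auto simp: H_def)
    then have "inv a \<otimes> h \<otimes> a = h"
      using a by (simp add: m_assoc)
    with h show "h \<in> {g \<in> carrier G. inv a \<otimes> g \<otimes> a = g}" by simp
  qed
qed

text \<open>The isomorphism sends \<open>g^-1 a g\<close> to the coset of \<open>g\<close>, which is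
  the orbit-stabilizer bijection, \<open>H\<close> being the stabilizer of \<open>a\<close>.\<close>

lemma (in group) conjugacy_class_isomorphic_Q:
  assumes a: "a \<in> carrier G" and H_def: "H = {h \<in> carrier G. h \<otimes> a = a \<otimes> h}"
    and Y: "Y = (\<lambda>g. inv g \<otimes> a \<otimes> g) ` carrier G"
  shows "quandle_isomorphic (Conj_on G Y) (Q G H (\<lambda>g. inv a \<otimes> g \<otimes> a))"
proof -
  interpret T: quandle_triplet G H "\<lambda>g. inv a \<otimes> g \<otimes> a"
    by (rule quandle_triplet_centralizer[OF a H_def])
  define \<pi> where "\<pi> g = inv g \<otimes> a \<otimes> g" for g
  \<comment> \<open>Any conjugator may be picked: by \<open>same\<close> its coset depends only on
    \<open>x\<close>.\<close>
  define f where "f x = H #> (SOME g. g \<in> carrier G \<and> \<pi> g = x)" for x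
  have same: "\<pi> g = \<pi> k \<longleftrightarrow> H #> g = H #> k" if "g \<in> carrier G" "k \<in> carrier G" for g k
    unfolding \<pi>_def by (rule conj_eq_iff_same_coset[OF a H_def that])
  have f: "f (\<pi> g) = H #> g" if "g \<in> carrier G" for g
    using someI[of "\<lambda>k. k \<in> carrier G \<and> \<pi> k = \<pi> g" g] that same unfolding f_def by blast
  have Y': "Y = \<pi> ` carrier G" by (simp add: Y \<pi>_def)
  have "bij_betw f Y (rcosets H)"
    unfolding bij_betw_def inj_on_def Y' RCOSETS_def using f same by (auto simp: image_image)
  moreover have "f (inv y \<otimes> x \<otimes> y) = f x \<triangleleft>\<^bsub>Q G H (\<lambda>g. inv a \<otimes> g \<otimes> a)\<^esub> f y"
    if "x \<in> Y" "y \<in> Y" for x y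
  proof -
    obtain g k where g: "g \<in> carrier G" "x = \<pi> g" and k: "k \<in> carrier G" "y = \<pi> k"
      using \<open>x \<in> Y\<close> \<open>y \<in> Y\<close> unfolding Y' by blast
    \<comment> \<open>The direct conjugator is \<open>g k^-1 a k\<close>. An extra left factor
      \<open>inv a\<close> is harmless, as it commutes with \<open>a\<close>, and yields the
      representative used in the coset operation.\<close>
    have "inv y \<otimes> x \<otimes> y = \<pi> (inv a \<otimes> (g \<otimes> inv k) \<otimes> a \<otimes> k)"
      using g k a by (simp add: \<pi>_def m_assoc inv_mult_group)
    moreover have "f (\<pi> (inv a \<otimes> (g \<otimes> inv k) \<otimes> a \<otimes> k)) = H #> (inv a \<otimes> (g \<otimes> inv k) \<otimes> a \<otimes> k)"
      using g k a by (intro f) simp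
    ultimately show ?thesis
      using g k by (simp add: f T.qop_Q)
  qed
  ultimately show ?thesis
    unfolding quandle_isomorphic_def by (intro exI[of _ f]) (auto simp: Conj_on_def Q_def)
qed

subsection \<open>Quotient maps\<close>

text \<open>Openness of the full image identifies the \<open>topspace\<close> of the quotient; the
  rest is the description of its open sets.\<close>

lemma quotient_map_quotient_topology: "quotient_map X (quotient_topology X f) f"
proof -
  have "{x \<in> topspace X. f x \<in> f ` topspace X} = topspace X" by auto
  then have "openin (quotient_topology X f) (f ` topspace X)"
    by (simp add: openin_quotient_topology)
  then have "topspace (quotient_topology X f) = f ` topspace X"
    by (metis openin_quotient_topology openin_subset openin_topspace subset_antisym)
  then show ?thesis
    by (simp add: quotient_map_def openin_quotient_topology)
qed

text \<open>By the universal property each map factors continuously through the other; the factors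
  are mutually inverse because \<open>f\<close> and \<open>g\<close> are surjective.\<close>

lemma quotient_maps_same_fibres_imp_homeomorphic:
  assumes f: "quotient_map X Y f" and g: "quotient_map X Z g"
    and fib: "\<And>x x'. \<lbrakk>x \<in> topspace X; x' \<in> topspace X\<rbrakk> \<Longrightarrow> f x = f x' \<longleftrightarrow> g x = g x'"
  shows "Y homeomorphic_space Z"
proof -
  obtain h where h: "continuous_map Y Z h" "\<And>x. x \<in> topspace X \<Longrightarrow> h (f x) = g x"
    using quotient_map_lift_exists[OF f quotient_imp_continuous_map[OF g]] fib by metis
  obtain k where k: "continuous_map Z Y k" "\<And>x. x \<in> topspace X \<Longrightarrow> k (g x) = f x"
    using quotient_map_lift_exists[OF g quotient_imp_continuous_map[OF f]] fib by metis
  have "homeomorphic_maps Y Z h k"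
    unfolding homeomorphic_maps_def using h k f g by (auto simp flip: quotient_imp_surjective_map)
  then show ?thesis by (auto simp: homeomorphic_space_def)
qed

text \<open>A section over \<open>W\<close> pulls the preimage of \<open>U\<close> under
  \<open>f\<close> back to \<open>W \<inter> U\<close>, so if that preimage is open,
  \<open>U\<close> is open near each of its points.\<close>

lemma local_sections_imp_quotient_map:
  assumes cont: "continuous_map X Y f"
    and sec: "\<And>y. y \<in> topspace Y \<Longrightarrow> \<exists>W s. openin Y W \<and> y \<in> W \<and>
      continuous_map (subtopology Y W) X s \<and> (\<forall>w\<in>W. f (s w) = w)"
  shows "quotient_map X Y f"
  unfolding quotient_map_def
proof (intro conjI allI impI)
  show surj: "f ` topspace X = topspace Y"
  proof
    show "f ` topspace X \<subseteq> topspace Y"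
      using cont by (simp add: continuous_map_image_subset_topspace)
    show "topspace Y \<subseteq> f ` topspace X"
    proof
      fix y assume y: "y \<in> topspace Y"
      then obtain W s where "y \<in> W" "continuous_map (subtopology Y W) X s" "f (s y) = y"
        using sec by metis
      with y show "y \<in> f ` topspace X"
        by (intro image_eqI[of _ _ "s y"]) (auto simp: continuous_map_def)
    qed
  qed
  fix U assume U: "U \<subseteq> topspace Y"
  show "openin X {x \<in> topspace X. f x \<in> U} = openin Y U"
  proof
    assume o: "openin X {x \<in> topspace X. f x \<in> U}"
    show "openin Y U"
      unfolding openin_subopen[of Y U]
    proof
      fix y assume y: "y \<in> U"
      then obtain W s where W: "openin Y W" "y \<in> W" and
        s: "continuous_map (subtopology Y W) X s" "\<And>w. w \<in> W \<Longrightarrow> f (s w) = w"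
        using sec U by (metis subsetD)
      have "openin (subtopology Y W) {w \<in> topspace (subtopology Y W). s w \<in> {x \<in> topspace X. f x \<in> U}}"
        using s(1) o by (rule openin_continuous_map_preimage)
      moreover have "{w \<in> topspace (subtopology Y W). s w \<in> {x \<in> topspace X. f x \<in> U}} = W \<inter> U"
        using s W U by (auto simp: continuous_map_def)
      ultimately show "\<exists>T. openin Y T \<and> y \<in> T \<and> T \<subseteq> U"
        using W y by (metis IntI Int_lower2 openin_trans_full)
    qed
  qed (use cont in \<open>rule openin_continuous_map_preimage\<close>)
qed

subsection \<open>Two by two matrices\<close>

lemma mat22_eq_iff:
  "A = mat22 a b c d \<longleftrightarrow> A $ 1 $ 1 = a \<and> A $ 1 $ 2 = b \<and> A $ 2 $ 1 = c \<and> A $ 2 $ 2 = d"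
  by (simp add: vec_eq_iff forall_2)

lemma mat22_cases:
  obtains a b c d where "A = mat22 a b c d"
  using mat22_eq_iff by metis

lemma mat22_mult:
  "mat22 a b c d ** mat22 a' b' c' d'
    = mat22 (a * a' + b * c') (a * b' + b * d') (c * a' + d * c') (c * b' + d * d')"
  by (simp add: vec_eq_iff forall_2 matrix_matrix_mult_def sum_2)

lemma det_mat22: "det (mat22 a b c d) = a * d - b * c"
  by (simp add: det_2)

lemma trace_mat22: "trace (mat22 a b c d) = a + d"
  by (simp add: trace_def sum_2)

lemma mat_1_eq_mat22: "mat 1 = mat22 1 0 0 1"
  and minus_mat22: "- mat22 a b c d = mat22 (- a) (- b) (- c) (- d)"
  by (simp_all add: vec_eq_iff forall_2 mat_def)

text \<open>The adjugate, which is the inverse when the determinant is \<open>1\<close>; its entries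
  are linear in those of \<open>A\<close>, which makes the continuity of inversion visible.\<close>

definition adj22 :: "complex^2^2 \<Rightarrow> complex^2^2" where
  "adj22 A = mat22 (A $ 2 $ 2) (- A $ 1 $ 2) (- A $ 2 $ 1) (A $ 1 $ 1)"

section \<open>The group SL(2,C) and its non-central elements of given trace\<close>

lemma in_SL2_iff: "A \<in> carrier SL2 \<longleftrightarrow> det A = 1"
  and mult_SL2 [simp]: "A \<otimes>\<^bsub>SL2\<^esub> B = A ** B"
  and one_SL2 [simp]: "\<one>\<^bsub>SL2\<^esub> = mat 1"
  by (simp_all add: SL2_def)

interpretation SL2: group SL2
  by (rule group_SL2)

lemma inv_SL2: "A \<in> carrier SL2 \<Longrightarrow> inv\<^bsub>SL2\<^esub> A = adj22 A"
proof (rule SL2.inv_equality)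
  assume "A \<in> carrier SL2"
  then show "adj22 A \<otimes>\<^bsub>SL2\<^esub> A = \<one>\<^bsub>SL2\<^esub>" "adj22 A \<in> carrier SL2"
    by (cases A rule: mat22_cases;
        simp add: adj22_def mat22_mult in_SL2_iff det_mat22 mat_1_eq_mat22 algebra_simps)+
qed

lemma inv_mat22: "a * d - b * c = 1 \<Longrightarrow> inv\<^bsub>SL2\<^esub> (mat22 a b c d) = mat22 d (- b) (- c) a"
  by (simp add: inv_SL2 in_SL2_iff det_mat22 adj22_def)

text \<open>A scalar matrix of determinant \<open>1\<close> is \<open>mat 1\<close> or
  \<open>- mat 1\<close>, so removing these two leaves exactly the non-scalar matrices.\<close>

lemma in_X_tilde_iff:
  "mat22 a b c d \<in> X_tilde t \<longleftrightarrow>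
    a * d - b * c = 1 \<and> a + d = t \<and> (b \<noteq> 0 \<or> c \<noteq> 0 \<or> a \<noteq> d)"
proof -
  have "a = 1 \<or> a = -1" if "a * a = 1"
    using that by (metis power2_eq_1_iff power2_eq_square)
  then show ?thesis
    by (auto simp: X_tilde_def in_SL2_iff det_mat22 trace_mat22 mat_1_eq_mat22
        minus_mat22 mat22_eq_iff)
qed

lemma X_tilde_subset_SL2: "X_tilde t \<subseteq> carrier SL2"
  by (auto simp: X_tilde_def)

lemma SL2_eq_center_Un_X_tilde: "carrier SL2 = {mat 1} \<union> {- mat 1} \<union> (\<Union>t. X_tilde t)"
  by (auto simp: X_tilde_def mat_1_eq_mat22 minus_mat22 in_SL2_iff det_mat22)

lemma conj_center_SL2:
  assumes "g \<in> carrier SL2" and "z \<in> {mat 1, - mat 1}"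
  shows "g ** z ** inv\<^bsub>SL2\<^esub> g = z"
proof -
  obtain a b c d where "g = mat22 a b c d" by (rule mat22_cases)
  then have gz: "z \<in> carrier SL2" "g \<otimes>\<^bsub>SL2\<^esub> z = z \<otimes>\<^bsub>SL2\<^esub> g"
    using assms(2)
    by (auto simp: mat22_mult mat_1_eq_mat22 minus_mat22 in_SL2_iff det_mat22)
  then have "g \<otimes>\<^bsub>SL2\<^esub> z \<otimes>\<^bsub>SL2\<^esub> inv\<^bsub>SL2\<^esub> g = z"
    using assms(1) by (simp only: SL2.m_assoc SL2.r_inv SL2.r_one SL2.inv_closed)
  then show ?thesis by simp
qed

lemma conj_X_tilde:
  assumes x: "x \<in> X_tilde t" and g: "g \<in> carrier SL2"
  shows "g ** x ** inv\<^bsub>SL2\<^esub> g \<in> X_tilde t"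
proof -
  let ?y = "g \<otimes>\<^bsub>SL2\<^esub> x \<otimes>\<^bsub>SL2\<^esub> inv\<^bsub>SL2\<^esub> g"
  have xG: "x \<in> carrier SL2" using x X_tilde_subset_SL2 by blast
  have y: "?y \<in> carrier SL2" using xG g by (simp del: mult_SL2)
  have conj_back: "inv\<^bsub>SL2\<^esub> g \<otimes>\<^bsub>SL2\<^esub> ?y \<otimes>\<^bsub>SL2\<^esub> g = x"
    using xG g by (simp add: SL2.m_assoc del: mult_SL2 one_SL2)
  \<comment> \<open>A central \<open>?y\<close> would be fixed by the inverse conjugation, which
    returns \<open>x\<close>; then \<open>x\<close> itself would be central.\<close>
  have "?y \<notin> {mat 1, - mat 1}"
  proof
    assume yz: "?y \<in> {mat 1, - mat 1}"
    then have "inv\<^bsub>SL2\<^esub> g ** ?y ** inv\<^bsub>SL2\<^esub> (inv\<^bsub>SL2\<^esub> g) = ?y"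
      using g by (intro conj_center_SL2) auto
    with conj_back yz g x show False by (auto simp: X_tilde_def)
  qed
  moreover have "trace ?y = trace x"
  proof -
    have "trace ?y = trace (inv\<^bsub>SL2\<^esub> g ** (g ** x))"
      by (simp add: trace_mul_sym[of "g ** x"])
    also have "inv\<^bsub>SL2\<^esub> g ** (g ** x) = x"
      using SL2.inv_mult_cancel(1)[OF g xG] by simp
    finally show ?thesis .
  qed
  ultimately show ?thesis
    using x y by (auto simp: X_tilde_def)
qed

lemma conj_closed_X_tilde: "conj_closed SL2 (X_tilde t)"
  by unfold_locales (use X_tilde_subset_SL2 conj_X_tilde in auto)


subsection \<open>Conjugation to the companion matrix\<close>

definition companion :: "complex \<Rightarrow> complex^2^2" where
  "companion t = mat22 0 1 (-1) t"

text \<open>The rows of \<open>frame p q B\<close> are \<open>v = (p, q)\<close> and \<open>vB\<close>. By the Cayley--Hamilton theorem they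
  conjugate \<open>B\<close> to the companion matrix as soon as they are linearly independent.\<close>

definition frame :: "complex \<Rightarrow> complex \<Rightarrow> complex^2^2 \<Rightarrow> complex^2^2" where
  "frame p q B = mat22 p q (p * B $ 1 $ 1 + q * B $ 2 $ 1) (p * B $ 1 $ 2 + q * B $ 2 $ 2)"

text \<open>The determinant is a quadratic form in \<open>(p, q)\<close>, so dividing by a square
  root of its value normalises it to \<open>1\<close>. For \<open>r = 0\<close> both sides are
  \<open>0\<close>, since division by zero gives \<open>0\<close>.\<close>

lemma det_frame_divide: "det (frame (p / r) (q / r) B) = det (frame p q B) / r\<^sup>2"
  by (cases "r = 0") (simp_all add: frame_def det_mat22 field_simps power2_eq_square)

lemma conj_frame:
  assumes B: "B \<in> X_tilde t" and f: "det (frame p q B) = 1"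
  shows "inv\<^bsub>SL2\<^esub> (frame p q B) ** companion t ** frame p q B = B"
proof -
  obtain a b c d where abcd: "B = mat22 a b c d" by (rule mat22_cases)
  have B': "a * d - b * c = 1" "a + d = t"
    using B by (auto simp: abcd in_X_tilde_iff)
  have t: "t = a + d" using B' by simp
  \<comment> \<open>Both products have the rows \<open>vB\<close> and \<open>vB^2\<close>, as
    \<open>vB^2 = t vB - v\<close> by Cayley--Hamilton.\<close>
  have "companion t ** frame p q B = frame p q B ** B"
    using B'(1) unfolding abcd frame_def companion_def t
    by (simp add: mat22_mult mat22_eq_iff) algebra
  then have "inv\<^bsub>SL2\<^esub> (frame p q B) ** (companion t ** frame p q B) = B"
    using SL2.inv_mult_cancel(1)[of "frame p q B" B] f B X_tilde_subset_SL2[of t]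
    by (auto simp: in_SL2_iff)
  then show ?thesis by (simp add: matrix_mul_assoc)
qed

text \<open>A non-zero vector fails only if it is a row eigenvector of \<open>B\<close>; if
  \<open>(1, 0)\<close>, \<open>(0, 1)\<close> and \<open>(1, 1)\<close> all are, then
  \<open>B\<close> is scalar.\<close>

lemma ex_frame:
  assumes "B \<in> X_tilde t"
  shows "\<exists>p q. det (frame p q B) = 1"
proof -
  obtain a b c d where abcd: "B = mat22 a b c d" by (rule mat22_cases)
  have "b \<noteq> 0 \<or> c \<noteq> 0 \<or> a \<noteq> d"
    using assms by (simp add: abcd in_X_tilde_iff)
  then have "det (frame 1 0 B) \<noteq> 0 \<or> det (frame 0 1 B) \<noteq> 0 \<or> det (frame 1 1 B) \<noteq> 0"
    by (auto simp: abcd frame_def det_mat22)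
  then obtain p q where "det (frame p q B) \<noteq> 0" by blast
  then have "det (frame (p / csqrt (det (frame p q B))) (q / csqrt (det (frame p q B))) B) = 1"
    by (simp add: det_frame_divide)
  then show ?thesis by blast
qed

lemma X_tilde_conj_companion:
  assumes "B \<in> X_tilde t"
  obtains g where "g \<in> carrier SL2" "inv\<^bsub>SL2\<^esub> g ** companion t ** g = B"
  using ex_frame[OF assms] conj_frame[OF assms] by (metis in_SL2_iff)

lemma X_tilde_conjugate:
  assumes A: "A \<in> X_tilde t" and B: "B \<in> X_tilde t"
  obtains g where "g \<in> carrier SL2" "inv\<^bsub>SL2\<^esub> g ** A ** g = B"
proof -
  have C: "companion t \<in> carrier SL2" by (simp add: companion_def in_SL2_iff det_mat22)
  obtain h where h: "h \<in> carrier SL2" "inv\<^bsub>SL2\<^esub> h \<otimes>\<^bsub>SL2\<^esub> companion t \<otimes>\<^bsub>SL2\<^esub> h = A"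
    using X_tilde_conj_companion[OF A] by auto
  obtain g where g: "g \<in> carrier SL2" "inv\<^bsub>SL2\<^esub> g \<otimes>\<^bsub>SL2\<^esub> companion t \<otimes>\<^bsub>SL2\<^esub> g = B"
    using X_tilde_conj_companion[OF B] by auto
  let ?k = "inv\<^bsub>SL2\<^esub> h \<otimes>\<^bsub>SL2\<^esub> g"
  have "inv\<^bsub>SL2\<^esub> ?k \<otimes>\<^bsub>SL2\<^esub> A \<otimes>\<^bsub>SL2\<^esub> ?k = B"
    using g h C by (auto simp: SL2.m_assoc SL2.inv_mult_group simp del: mult_SL2)
  moreover have "?k \<in> carrier SL2" using g h by (simp del: mult_SL2)
  ultimately show ?thesis using that by simp
qed

lemma X_tilde_eq_conjugates:
  assumes "A \<in> X_tilde t"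
  shows "X_tilde t = (\<lambda>g. inv\<^bsub>SL2\<^esub> g ** A ** g) ` carrier SL2"
proof
  interpret conj_closed SL2 "X_tilde t" by (rule conj_closed_X_tilde)
  show "(\<lambda>g. inv\<^bsub>SL2\<^esub> g ** A ** g) ` carrier SL2 \<subseteq> X_tilde t"
    using conj_cl'[OF assms] by auto
qed (use X_tilde_conjugate[OF assms] in blast)

lemma X_tilde_eq_conjugates':
  assumes "A \<in> X_tilde t"
  shows "X_tilde t = (\<lambda>g. g ** A ** inv\<^bsub>SL2\<^esub> g) ` carrier SL2"
proof
  show "(\<lambda>g. g ** A ** inv\<^bsub>SL2\<^esub> g) ` carrier SL2 \<subseteq> X_tilde t"
    using conj_X_tilde[OF assms] by auto
  show "X_tilde t \<subseteq> (\<lambda>g. g ** A ** inv\<^bsub>SL2\<^esub> g) ` carrier SL2"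
  proof
    fix B assume "B \<in> X_tilde t"
    then obtain g where "g \<in> carrier SL2" "inv\<^bsub>SL2\<^esub> g ** A ** g = B"
      by (rule X_tilde_conjugate[OF assms])
    then show "B \<in> (\<lambda>g. g ** A ** inv\<^bsub>SL2\<^esub> g) ` carrier SL2"
      by (intro image_eqI[of _ _ "inv\<^bsub>SL2\<^esub> g"]) auto
  qed
qed


subsection \<open>Generation by one class\<close>

text \<open>In every case \<open>l\<close> is a root of \<open>x^2 - t x + 1\<close>, that is, an
  eigenvalue of the matrices in \<open>X_tilde t\<close>.\<close>

lemma is_lambda_trace:
  assumes "is_lambda t l"
  shows "l \<noteq> 0" "t = l + inverse l"
proof -
  have "l \<noteq> 0 \<and> t = l + inverse l"
    using assms unfolding is_lambda_def
  proof (elim disjE exE conjE)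
    fix \<theta> :: real
    assume "t = complex_of_real (2 * cos \<theta>)" "l = cis \<theta>"
    then show ?thesis by (auto simp add: cis_inverse) (simp add: complex_eq_iff)
  qed auto
  then show "l \<noteq> 0" "t = l + inverse l" by auto
qed

lemma generate_X_tilde: "generate SL2 (X_tilde t) = carrier SL2"
proof -
  let ?K = "generate SL2 (X_tilde t)"
  have K: "subgroup ?K SL2"
    by (rule SL2.generate_is_subgroup[OF X_tilde_subset_SL2])
  have mult: "A ** B \<in> ?K" if "A \<in> ?K" "B \<in> ?K" for A B
    using subgroup.m_closed[OF K that] by simp
  have inv: "inv\<^bsub>SL2\<^esub> A \<in> ?K" if "A \<in> ?K" for A
    using subgroup.m_inv_closed[OF K that] by simp
  obtain l where l: "l \<noteq> 0" "t = l + inverse l"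
    using ex_is_lambda is_lambda_trace by metis
  \<comment> \<open>If \<open>l = inverse l\<close>, a zero off-diagonal entry would give a central
    matrix, so \<open>z\<close> is written with two non-zero entries. Taking \<open>y = 1\<close>
    works unless \<open>z = - l\<close>.\<close>
  have two: "\<exists>x y. x \<noteq> 0 \<and> y \<noteq> 0 \<and> l * (x - y) = z" for z
  proof (cases "z + l = 0")
    case True
    then have "l * (1 - 2) = z" by (simp add: add_eq_0_iff)
    then show ?thesis by (metis one_neq_zero zero_neq_numeral)
  next
    case False
    then show ?thesis
      using l by (intro exI[of _ "(z + l) / l"] exI[of _ 1]) (simp add: field_simps)
  qed
  \<comment> \<open>Quotients of two triangular elements of the class are transvections.\<close>
  have U: "mat22 1 z 0 1 \<in> ?K" and L: "mat22 1 0 z 1 \<in> ?K" for z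
  proof -
    obtain x y where xy: "x \<noteq> 0" "y \<noteq> 0" "l * (x - y) = z" using two by blast
    have up: "mat22 l w 0 (inverse l) \<in> ?K" and lo: "mat22 (inverse l) 0 w l \<in> ?K" if "w \<noteq> 0" for w
      using that l by (auto intro!: generate.incl simp: in_X_tilde_iff)
    have "mat22 l x 0 (inverse l) ** inv\<^bsub>SL2\<^esub> (mat22 l y 0 (inverse l)) \<in> ?K"
      by (intro mult inv up xy)
    then show "mat22 1 z 0 1 \<in> ?K"
      using l xy by (simp add: inv_mat22 mat22_mult algebra_simps)
    have "mat22 (inverse l) 0 x l ** inv\<^bsub>SL2\<^esub> (mat22 (inverse l) 0 y l) \<in> ?K"
      by (intro mult inv lo xy)
    then show "mat22 1 0 z 1 \<in> ?K"
      using l xy by (simp add: inv_mat22 mat22_mult algebra_simps)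
  qed
  have big: "mat22 a b c d \<in> ?K" if "a * d - b * c = 1" "c \<noteq> 0" for a b c d
  proof -
    \<comment> \<open>The outer factors are chosen to match \<open>a\<close> and \<open>d\<close>;
      the determinant then forces \<open>b\<close>, because \<open>c\<close> is non-zero.\<close>
    have "mat22 a b c d = mat22 1 ((a - 1) / c) 0 1 ** mat22 1 0 c 1 ** mat22 1 ((d - 1) / c) 0 1"
      using that by (simp add: mat22_mult mat22_eq_iff field_simps)
    then show ?thesis using mult U L by metis
  qed
  have "A \<in> ?K" if "A \<in> carrier SL2" for A
  proof -
    obtain a b c d where A: "A = mat22 a b c d" by (rule mat22_cases)
    have det: "a * d - b * c = 1" using that by (simp add: A in_SL2_iff det_mat22)
    show ?thesis
    proof (cases "c = 0")
      case True
      then have "d \<noteq> 0" using det by auto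
      \<comment> \<open>Adding the second column to the first puts the non-zero \<open>d\<close> in
        the lower left corner; the transvection below undoes this.\<close>
      with True det have "mat22 (a + b) b d d \<in> ?K"
        by (intro big) (auto simp: algebra_simps)
      then have "mat22 (a + b) b d d ** mat22 1 0 (-1) 1 \<in> ?K"
        by (intro mult L)
      then show ?thesis using True by (simp add: A mat22_mult)
    qed (use big det A in auto)
  qed
  then show ?thesis
    using SL2.generate_incl[OF X_tilde_subset_SL2] by blast
qed

section \<open>Components and connectedness for SL(2,C)\<close>

lemma companion_in_X_tilde: "companion t \<in> X_tilde t"
  by (simp add: companion_def in_X_tilde_iff)

text \<open>The components are the conjugacy classes: central elements are alone in theirs, and on
  the others the trace is a complete invariant.\<close>

lemma quandle_components_Conj_SL2:
  "quandle_components (Conj SL2) = {{mat 1}, {- mat 1}} \<union> range X_tilde"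
proof -
  define cl where "cl x = (\<lambda>g. g ** x ** inv\<^bsub>SL2\<^esub> g) ` carrier SL2" for x
  have center: "cl z = {z}" if "z \<in> {mat 1, - mat 1}" for z
  proof -
    have "cl z = (\<lambda>g. z) ` carrier SL2"
      unfolding cl_def by (intro image_cong refl conj_center_SL2 that)
    then show ?thesis using SL2.one_closed by (auto simp: image_constant_conv)
  qed
  have X: "cl ` X_tilde t = {X_tilde t}" for t
  proof -
    have "cl ` X_tilde t = (\<lambda>_. X_tilde t) ` X_tilde t"
      unfolding cl_def by (intro image_cong refl X_tilde_eq_conjugates'[symmetric])
    then show ?thesis using companion_in_X_tilde[of t] by (simp add: image_constant)
  qed
  have "quandle_components (Conj SL2) = cl ` carrier SL2"
    unfolding SL2.quandle_components_Conj by (simp add: cl_def Setcompr_eq_image)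
  also have "\<dots> = {cl (mat 1), cl (- mat 1)} \<union> (\<Union>t. cl ` X_tilde t)"
    unfolding SL2_eq_center_Un_X_tilde image_Un image_UN by (simp add: insert_commute)
  finally show ?thesis
    by (simp add: center X UNION_singleton_eq_range)
qed

lemma connected_Conj_X_tilde: "connected_quandle (Conj_on SL2 (X_tilde t))"
proof -
  interpret conj_closed SL2 "X_tilde t" by (rule conj_closed_X_tilde)
  show ?thesis
    by (rule connected_Conj_on[OF generate_X_tilde companion_in_X_tilde])
      (use X_tilde_eq_conjugates'[OF companion_in_X_tilde] in auto)
qed

lemma subquandle_X_tilde: "subquandle (X_tilde t) (Conj SL2)"
proof -
  have "Conj SL2\<lparr>carrier := X_tilde t\<rparr> = Conj_on SL2 (X_tilde t)"
    by (simp add: Conj_on_def)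
  then show ?thesis
    using connected_Conj_X_tilde X_tilde_subset_SL2
    by (simp add: subquandle_def connected_quandle_def Conj_on_def)
qed


subsection \<open>The centralizer of the representative\<close>

text \<open>For \<open>t\<close> other than \<open>2\<close> and \<open>-2\<close> the eigenvalues
  \<open>l\<close> and \<open>inverse l\<close> differ, so the diagonal matrix is not scalar;
  otherwise the off-diagonal \<open>1\<close> ensures this.\<close>

lemma A_mat_in_X_tilde:
  assumes "is_lambda t l"
  shows "A_mat t l \<in> X_tilde t"
proof -
  note l = is_lambda_trace[OF assms]
  have "l \<noteq> inverse l" if "t \<noteq> 2" "t \<noteq> -2"
  proof
    assume eq: "l = inverse l"
    then have "l\<^sup>2 = 1"
      using l by (simp add: power2_eq_square field_simps)
    then show False
      using l that by (auto simp: power2_eq_1_iff)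
  qed
  then show ?thesis
    using l by (auto simp: A_mat_def in_X_tilde_iff)
qed

text \<open>Commuting with a diagonal matrix with distinct eigenvalues forces diagonal form;
  commuting with a Jordan block forces triangular form with equal diagonal entries.\<close>

lemma H_tilde_eq_centralizer:
  assumes "is_lambda t l"
  shows "H_tilde t = {h \<in> carrier SL2. h ** A_mat t l = A_mat t l ** h}"
proof (cases "t = 2 \<or> t = -2")
  case True
  note l = is_lambda_trace[OF assms]
  have "l * l = 1"
  proof -
    \<comment> \<open>At \<open>t = 2\<close> and \<open>t = -2\<close> the equation
      \<open>l^2 - t l + 1 = 0\<close> has a double root, \<open>1\<close> or
      \<open>-1\<close>.\<close>
    have tl: "t * l = l * l + 1" using l by (simp add: field_simps)
    from True have "l = 1 \<or> l = -1"
    proof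
      assume "t = 2"
      then have "(l - 1)\<^sup>2 = l * l + 1 - t * l" by (simp add: power2_eq_square algebra_simps)
      with tl show ?thesis by simp
    next
      assume "t = -2"
      then have "(l + 1)\<^sup>2 = l * l + 1 - t * l" by (simp add: power2_eq_square algebra_simps)
      with tl show ?thesis by (simp add: eq_neg_iff_add_eq_0)
    qed
    then show ?thesis by auto
  qed
  then have il: "inverse l = l" by (simp add: inverse_unique)
  show ?thesis
  proof (rule Set.set_eqI)
    fix A
    obtain a b c d where A: "A = mat22 a b c d" by (rule mat22_cases)
    have "A \<in> H_tilde t \<longleftrightarrow> (a = 1 \<or> a = -1) \<and> c = 0 \<and> d = a"
      using True by (auto simp: A H_tilde_def mat22_eq_iff)
    also have "a = 1 \<or> a = -1 \<longleftrightarrow> a * a = 1"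
      by (metis power2_eq_1_iff power2_eq_square)
    also have "\<dots> \<and> c = 0 \<and> d = a \<longleftrightarrow> det A = 1 \<and> A ** A_mat t l = A_mat t l ** A"
      using True by (auto simp: A A_mat_def il det_mat22 mat22_mult mat22_eq_iff algebra_simps)
    finally show "A \<in> H_tilde t \<longleftrightarrow> A \<in> {h \<in> carrier SL2. h ** A_mat t l = A_mat t l ** h}"
      by (simp add: in_SL2_iff)
  qed
next
  case False
  note l = is_lambda_trace[OF assms]
  have ne: "l \<noteq> inverse l"
    using A_mat_in_X_tilde[OF assms] False by (simp add: A_mat_def in_X_tilde_iff)
  show ?thesis
  proof (rule Set.set_eqI)
    fix A
    obtain a b c d where A: "A = mat22 a b c d" by (rule mat22_cases)
    have "A \<in> H_tilde t \<longleftrightarrow> b = 0 \<and> c = 0 \<and> a * d = 1"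
      using False by (auto simp: A H_tilde_def mat22_eq_iff inverse_unique)
    also have "\<dots> \<longleftrightarrow> det A = 1 \<and> A ** A_mat t l = A_mat t l ** A"
      using False ne by (auto simp: A A_mat_def det_mat22 mat22_mult mat22_eq_iff mult.commute)
    finally show "A \<in> H_tilde t \<longleftrightarrow> A \<in> {h \<in> carrier SL2. h ** A_mat t l = A_mat t l ** h}"
      by (simp add: in_SL2_iff)
  qed
qed

subsection \<open>Local sections of the orbit map\<close>

lemma vector_4 [simp]:
  "(vector [w, x, y, z] :: 'a::zero^4) $ 1 = w"
  "(vector [w, x, y, z] :: 'a::zero^4) $ 2 = x"
  "(vector [w, x, y, z] :: 'a::zero^4) $ 3 = y"
  "(vector [w, x, y, z] :: 'a::zero^4) $ 4 = z"
  unfolding vector_def by simp_all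

lemma continuous_on_vecI:
  assumes "\<And>i. continuous_on S (\<lambda>x. f x $ i)"
  shows "continuous_on S f"
  using continuous_on_vec_lambda[of S "\<lambda>i x. f x $ i"] assms by simp

lemma continuous_on_mat22:
  assumes "continuous_on S a" "continuous_on S b" "continuous_on S c" "continuous_on S d"
  shows "continuous_on S (\<lambda>x. mat22 (a x) (b x) (c x) (d x))"
proof (intro continuous_on_vecI)
  fix i j :: 2
  show "continuous_on S (\<lambda>x. mat22 (a x) (b x) (c x) (d x) $ i $ j)"
    using exhaust_2[of i] exhaust_2[of j] assms by auto
qed

lemma continuous_on_matrix_mult:
  fixes f :: "'a::topological_space \<Rightarrow> complex^'m^'n" and g :: "'a \<Rightarrow> complex^'k^'m"
  assumes "continuous_on S f" "continuous_on S g"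
  shows "continuous_on S (\<lambda>x. f x ** g x)"
  by (intro continuous_on_vecI) (simp add: matrix_matrix_mult_def, intro continuous_intros assms)

text \<open>Flattening is a homeomorphism from the space of matrices onto C^4, so the pulled back
  topology is the usual subspace topology.\<close>

lemma SL2_topology_eq: "SL2_topology = top_of_set (carrier SL2)"
  unfolding topology_eq
proof (intro allI iffI)
  define unflatten :: "complex^4 \<Rightarrow> complex^2^2"
    where "unflatten w = mat22 (w $ 1) (w $ 2) (w $ 3) (w $ 4)" for w
  have uf: "unflatten (flatten A) = A" for A
    by (cases A rule: mat22_cases) (simp add: unflatten_def flatten_def)
  have cu: "continuous_on UNIV unflatten"
    unfolding unflatten_def by (intro continuous_on_mat22 continuous_intros)
  have cf: "continuous_on UNIV flatten"
  proof (rule continuous_on_vecI)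
    fix i :: 4
    show "continuous_on UNIV (\<lambda>A. flatten A $ i)"
      using exhaust_4[of i]
      by (elim disjE; simp add: flatten_def; intro continuous_intros)
  qed
  fix S
  show "openin (top_of_set (carrier SL2)) S" if S: "openin SL2_topology S"
  proof -
    obtain U where "open U" "S = flatten -` U \<inter> carrier SL2"
      using S unfolding SL2_topology_def openin_pullback_topology by auto
    then show ?thesis
      using continuous_openin_preimage_gen[OF continuous_on_subset[OF cf subset_UNIV], of U "carrier SL2"]
      by (simp add: Int_commute)
  qed
  show "openin SL2_topology S" if S: "openin (top_of_set (carrier SL2)) S"
  proof -
    obtain T where T: "open T" "S = carrier SL2 \<inter> T"
      using S by (auto simp: openin_open)
    have "open (unflatten -` T)"
      using cu T(1) by (simp add: open_vimage)
    moreover have "S = flatten -` unflatten -` T \<inter> carrier SL2"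
      using T(2) uf by auto
    ultimately show ?thesis
      unfolding SL2_topology_def openin_pullback_topology by auto
  qed
qed

text \<open>A vector \<open>(p, q)\<close> suitable for one matrix stays suitable nearby, and its
  normalised frame is a conjugator that depends continuously on the matrix.\<close>

lemma quotient_map_conjugation:
  assumes A: "A \<in> X_tilde t"
  shows "quotient_map (top_of_set (carrier SL2)) (top_of_set (X_tilde t))
    (\<lambda>g. inv\<^bsub>SL2\<^esub> g ** A ** g)"
proof (rule local_sections_imp_quotient_map)
  have "continuous_on (carrier SL2) (\<lambda>g. adj22 g ** A ** g)"
    unfolding adj22_def
    by (intro continuous_on_matrix_mult continuous_on_mat22 continuous_intros)
  then have "continuous_on (carrier SL2) (\<lambda>g. inv\<^bsub>SL2\<^esub> g ** A ** g)"
    by (rule continuous_on_eq) (simp add: inv_SL2)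
  then show "continuous_map (top_of_set (carrier SL2)) (top_of_set (X_tilde t))
      (\<lambda>g. inv\<^bsub>SL2\<^esub> g ** A ** g)"
    using X_tilde_eq_conjugates[OF A] by (auto simp: continuous_map_subtopology_eu)
next
  have C: "companion t \<in> carrier SL2" by (simp add: companion_def in_SL2_iff det_mat22)
  obtain h where h: "h \<in> carrier SL2" "inv\<^bsub>SL2\<^esub> h \<otimes>\<^bsub>SL2\<^esub> companion t \<otimes>\<^bsub>SL2\<^esub> h = A"
    using X_tilde_conj_companion[OF A] by auto
  fix B0 assume "B0 \<in> topspace (top_of_set (X_tilde t))"
  then have B0: "B0 \<in> X_tilde t" by simp
  obtain p q where pq: "det (frame p q B0) = 1" using ex_frame[OF B0] by blast
  define \<delta> where "\<delta> B = det (frame p q B)" for B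
  \<comment> \<open>Leaving out the branch cut keeps \<open>csqrt\<close> continuous and non-zero;
    \<open>B0\<close> lies in \<open>W\<close> because \<open>\<delta> B0 = 1\<close>.\<close>
  define W where "W = {B \<in> X_tilde t. \<delta> B \<notin> \<real>\<^sub>\<le>\<^sub>0}"
  define f where "f B = frame (p / csqrt (\<delta> B)) (q / csqrt (\<delta> B)) B" for B
  \<comment> \<open>Frames conjugate the companion matrix to \<open>B\<close>; the left factor
    \<open>inv h\<close> makes \<open>A\<close> the starting point instead.\<close>
  define s where "s B = inv\<^bsub>SL2\<^esub> h ** f B" for B
  have c\<delta>: "continuous_on S \<delta>" for S
    unfolding \<delta>_def frame_def det_mat22 by (intro continuous_intros)
  have det_f: "det (f B) = 1" if "B \<in> W" for B
    using that by (auto simp: f_def W_def \<delta>_def det_frame_divide)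
  have "continuous_on W (\<lambda>B. csqrt (\<delta> B))"
    by (rule continuous_on_compose2[OF continuous_on_csqrt c\<delta>]) (auto simp: W_def)
  moreover have "csqrt (\<delta> B) \<noteq> 0" if "B \<in> W" for B
    using that by (auto simp: W_def)
  ultimately have "continuous_on W f"
    unfolding f_def frame_def by (intro continuous_on_mat22 continuous_intros) auto
  then have cs: "continuous_on W s"
    unfolding s_def by (intro continuous_on_matrix_mult continuous_intros)
  have sW: "s B \<in> carrier SL2" "inv\<^bsub>SL2\<^esub> (s B) ** A ** s B = B" if "B \<in> W" for B
  proof -
    have fB: "f B \<in> carrier SL2" using det_f[OF that] by (simp add: in_SL2_iff)
    have sB: "s B = inv\<^bsub>SL2\<^esub> h \<otimes>\<^bsub>SL2\<^esub> f B" by (simp add: s_def)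
    show "s B \<in> carrier SL2"
      unfolding sB using fB h by (intro SL2.m_closed) auto
    have "inv\<^bsub>SL2\<^esub> (s B) \<otimes>\<^bsub>SL2\<^esub> A \<otimes>\<^bsub>SL2\<^esub> s B
        = inv\<^bsub>SL2\<^esub> (f B) \<otimes>\<^bsub>SL2\<^esub> companion t \<otimes>\<^bsub>SL2\<^esub> f B"
      unfolding sB h(2)[symmetric] using fB h(1) C
      by (simp add: SL2.m_assoc SL2.inv_mult_group del: mult_SL2)
    also have "\<dots> = B"
      using conj_frame[of B t] that det_f[OF that] by (auto simp: W_def f_def)
    finally show "inv\<^bsub>SL2\<^esub> (s B) ** A ** s B = B" by simp
  qed
  have "W = X_tilde t \<inter> \<delta> -` (- \<real>\<^sub>\<le>\<^sub>0)" by (auto simp: W_def)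
  then have "openin (top_of_set (X_tilde t)) W"
    using continuous_openin_preimage_gen[OF c\<delta>, of "- \<real>\<^sub>\<le>\<^sub>0" "X_tilde t"] by (simp add: open_Compl)
  moreover have "B0 \<in> W" using B0 pq by (simp add: W_def \<delta>_def)
  moreover have "subtopology (top_of_set (X_tilde t)) W = top_of_set W"
    by (simp add: subtopology_subtopology W_def Int_absorb1)
  then have "continuous_map (subtopology (top_of_set (X_tilde t)) W) (top_of_set (carrier SL2)) s"
    using cs sW(1) by (auto simp: continuous_map_subtopology_eu)
  ultimately show "\<exists>W s. openin (top_of_set (X_tilde t)) W \<and> B0 \<in> W \<and>
      continuous_map (subtopology (top_of_set (X_tilde t)) W) (top_of_set (carrier SL2)) s \<and>
      (\<forall>w\<in>W. inv\<^bsub>SL2\<^esub> (s w) ** A ** s w = w)"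
    using sW(2) by blast
qed


subsection \<open>Holomorphic charts\<close>

text \<open>Scalar, pointwise counterpart of \<open>holomorphic_map_on\<close>, which lets chart
  maps be checked coordinate by coordinate with calculus rules.\<close>

definition holomorphic_at :: "(complex^'n \<Rightarrow> complex) \<Rightarrow> complex^'n \<Rightarrow> bool" where
  "holomorphic_at f z \<longleftrightarrow> (\<exists>D. (f has_derivative D) (at z) \<and> (\<forall>c v. D (c *s v) = c * D v))"

lemma holomorphic_at_const: "holomorphic_at (\<lambda>w. c) z"
  unfolding holomorphic_at_def by (intro exI[of _ "\<lambda>_. 0"]) simp

lemma holomorphic_at_nth: "holomorphic_at (\<lambda>w. w $ i) z"
  unfolding holomorphic_at_def
  by (intro exI[of _ "\<lambda>v. v $ i"]) (auto intro: bounded_linear_imp_has_derivative)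

lemma holomorphic_at_add:
  assumes "holomorphic_at f z" "holomorphic_at g z"
  shows "holomorphic_at (\<lambda>w. f w + g w) z"
proof -
  obtain D E where "(f has_derivative D) (at z)" "\<forall>c v. D (c *s v) = c * D v"
    "(g has_derivative E) (at z)" "\<forall>c v. E (c *s v) = c * E v"
    using assms unfolding holomorphic_at_def by blast
  then show ?thesis
    unfolding holomorphic_at_def
    by (intro exI[of _ "\<lambda>v. D v + E v"]) (auto intro: has_derivative_add simp: algebra_simps)
qed

lemma holomorphic_at_mult:
  assumes "holomorphic_at f z" "holomorphic_at g z"
  shows "holomorphic_at (\<lambda>w. f w * g w) z"
proof -
  obtain D E where "(f has_derivative D) (at z)" "\<forall>c v. D (c *s v) = c * D v"
    "(g has_derivative E) (at z)" "\<forall>c v. E (c *s v) = c * E v"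
    using assms unfolding holomorphic_at_def by blast
  then show ?thesis
    unfolding holomorphic_at_def
    by (intro exI[of _ "\<lambda>v. f z * E v + D v * g z"])
      (auto intro!: has_derivative_mult simp: distrib_left mult.left_commute mult.assoc)
qed

lemma holomorphic_at_diff:
  assumes "holomorphic_at f z" "holomorphic_at g z"
  shows "holomorphic_at (\<lambda>w. f w - g w) z"
  using holomorphic_at_add[OF assms(1) holomorphic_at_mult[OF holomorphic_at_const[of "-1"] assms(2)]]
  by simp

lemma holomorphic_at_inverse:
  assumes "holomorphic_at f z" "f z \<noteq> 0"
  shows "holomorphic_at (\<lambda>w. inverse (f w)) z"
proof -
  obtain D where "(f has_derivative D) (at z)" "\<forall>c v. D (c *s v) = c * D v"
    using assms unfolding holomorphic_at_def by blast
  then show ?thesis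
    unfolding holomorphic_at_def using assms(2)
    by (intro exI[of _ "\<lambda>v. - (inverse (f z) * D v * inverse (f z))"])
      (auto intro!: has_derivative_inverse)
qed

lemma holomorphic_at_divide:
  assumes "holomorphic_at f z" "holomorphic_at g z" "g z \<noteq> 0"
  shows "holomorphic_at (\<lambda>w. f w / g w) z"
  using holomorphic_at_mult[OF assms(1) holomorphic_at_inverse[OF assms(2,3)]]
  by (simp add: divide_inverse)

lemmas holomorphic_at_intros =
  holomorphic_at_const holomorphic_at_nth holomorphic_at_add holomorphic_at_diff
  holomorphic_at_mult holomorphic_at_divide

lemma holomorphic_map_onI:
  fixes f :: "complex^'n \<Rightarrow> complex^'m"
  assumes "\<And>z i. z \<in> U \<Longrightarrow> holomorphic_at (\<lambda>w. f w $ i) z"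
  shows "holomorphic_map_on f U"
  unfolding holomorphic_map_on_def
proof
  fix z assume "z \<in> U"
  then have "\<forall>i. \<exists>D. ((\<lambda>w. f w $ i) has_derivative D) (at z) \<and> (\<forall>c v. D (c *s v) = c * D v)"
    using assms by (auto simp: holomorphic_at_def)
  then obtain D where D: "\<And>i. ((\<lambda>w. f w $ i) has_derivative D i) (at z)"
    "\<And>i c v. D i (c *s v) = c * D i v"
    by metis
  have "(f has_derivative (\<lambda>v. \<chi> i. D i v)) (at z)"
    unfolding has_derivative_componentwise_within[of f]
  proof
    \<comment> \<open>The criterion tests against the real basis, whose vectors have the form
      \<open>axis i c\<close>; pairing with one involves component \<open>i\<close> only.\<close>
    fix b :: "complex^'m" assume "b \<in> Basis"
    then obtain i c where "b = axis i c" by (auto simp: Basis_vec_def)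
    then show "((\<lambda>x. f x \<bullet> b) has_derivative (\<lambda>v. (\<chi> i. D i v) \<bullet> b)) (at z)"
      using has_derivative_inner_left[OF D(1)[of i]] by (simp add: inner_axis)
  qed
  then show "\<exists>D. (f has_derivative D) (at z) \<and> (\<forall>c v. D (c *s v) = c *s D v)"
    using D(2) by (intro exI[of _ "\<lambda>v. \<chi> i. D i v"]) (simp add: vec_eq_iff)
qed

lemma holomorphic_map_on_vector4:
  fixes f1 f2 f3 f4 :: "complex^'n \<Rightarrow> complex"
  assumes "\<And>z. z \<in> U \<Longrightarrow> holomorphic_at f1 z" "\<And>z. z \<in> U \<Longrightarrow> holomorphic_at f2 z"
    "\<And>z. z \<in> U \<Longrightarrow> holomorphic_at f3 z" "\<And>z. z \<in> U \<Longrightarrow> holomorphic_at f4 z"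
  shows "holomorphic_map_on (\<lambda>w. vector [f1 w, f2 w, f3 w, f4 w] :: complex^4) U"
proof (rule holomorphic_map_onI)
  fix z and i :: 4
  assume "z \<in> U"
  then show "holomorphic_at (\<lambda>w. (vector [f1 w, f2 w, f3 w, f4 w] :: complex^4) $ i) z"
    using exhaust_4[of i] assms by auto
qed

lemma holomorphic_map_on_compose:
  assumes f: "holomorphic_map_on f U" and g: "holomorphic_map_on g V" and sub: "f ` U \<subseteq> V"
  shows "holomorphic_map_on (\<lambda>w. g (f w)) U"
  unfolding holomorphic_map_on_def
proof
  fix z assume z: "z \<in> U"
  then obtain D where D: "(f has_derivative D) (at z)" "\<forall>c v. D (c *s v) = c *s D v"
    using f by (auto simp: holomorphic_map_on_def)
  obtain E where E: "(g has_derivative E) (at (f z))" "\<forall>c v. E (c *s v) = c *s E v"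
    using g sub z unfolding holomorphic_map_on_def by blast
  show "\<exists>D. ((\<lambda>w. g (f w)) has_derivative D) (at z) \<and> (\<forall>c v. D (c *s v) = c *s D v)"
    using has_derivative_compose[OF D(1) E(1)] D(2) E(2)
    by (intro exI[of _ "\<lambda>v. E (D v)"]) simp
qed

lemma holomorphic_map_on_imp_continuous_on: "holomorphic_map_on f U \<Longrightarrow> continuous_on U f"
  unfolding holomorphic_map_on_def
  by (meson continuous_at_imp_continuous_on has_derivative_continuous)

section \<open>Charts of the trace sets\<close>

lemma in_flatten_X_tilde_iff:
  "w \<in> flatten ` X_tilde t \<longleftrightarrow>
    w $ 1 * w $ 4 - w $ 2 * w $ 3 = 1 \<and> w $ 1 + w $ 4 = t \<and> (w $ 2 \<noteq> 0 \<or> w $ 3 \<noteq> 0 \<or> w $ 1 \<noteq> w $ 4)"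
proof -
  have "w \<in> flatten ` X_tilde t \<longleftrightarrow> mat22 (w $ 1) (w $ 2) (w $ 3) (w $ 4) \<in> X_tilde t"
  proof
    assume "w \<in> flatten ` X_tilde t"
    then obtain A where A: "A \<in> X_tilde t" "w = flatten A" by blast
    obtain a b c d where "A = mat22 a b c d" by (rule mat22_cases)
    with A show "mat22 (w $ 1) (w $ 2) (w $ 3) (w $ 4) \<in> X_tilde t"
      by (simp add: flatten_def)
  next
    assume "mat22 (w $ 1) (w $ 2) (w $ 3) (w $ 4) \<in> X_tilde t"
    then show "w \<in> flatten ` X_tilde t"
      by (rule rev_image_eqI) (simp add: flatten_def vec_eq_iff forall_4)
  qed
  then show ?thesis by (simp add: in_X_tilde_iff)
qed

text \<open>Where the lower left entry \<open>c\<close> does not vanish, determinant and trace complete \<open>a, c\<close> to a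
  coordinate system. The linear map \<open>L\<close> transports this chart to the points where \<open>c\<close> vanishes.\<close>

lemma X_tilde_chart:
  fixes L L' :: "complex^4 \<Rightarrow> complex^4"
  assumes L: "holomorphic_map_on L UNIV" and L': "holomorphic_map_on L' UNIV"
    and inv: "\<And>w. L' (L w) = w" "\<And>w. L (L' w) = w"
    and tr: "\<And>w. L w $ 1 + L w $ 4 = w $ 1 + w $ 4"
    and det: "\<And>w. L w $ 1 * L w $ 4 - L w $ 2 * L w $ 3 = w $ 1 * w $ 4 - w $ 2 * w $ 3"
    and nonscalar: "\<And>w. L w $ 3 \<noteq> 0 \<Longrightarrow> w $ 2 \<noteq> 0 \<or> w $ 3 \<noteq> 0 \<or> w $ 1 \<noteq> w $ 4"
    and p: "L p $ 3 \<noteq> 0"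
  shows "\<exists>U V (\<phi> :: complex^4 \<Rightarrow> complex^4) \<psi> J.
      open U \<and> p \<in> U \<and> open V \<and>
      homeomorphism U V \<phi> \<psi> \<and> holomorphic_map_on \<phi> U \<and> holomorphic_map_on \<psi> V \<and>
      card J = 2 \<and> \<phi> ` (flatten ` X_tilde t \<inter> U) = {w \<in> V. \<forall>i. i \<notin> J \<longrightarrow> w $ i = 0}"
proof -
  \<comment> \<open>Coordinates \<open>2\<close> and \<open>4\<close> measure how far determinant
    and trace are from \<open>1\<close> and \<open>t\<close>, so both vanish on the set;
    \<open>1\<close> and \<open>3\<close> remain free.\<close>
  define \<phi>0 :: "complex^4 \<Rightarrow> complex^4"
    where "\<phi>0 w = vector [w $ 1, w $ 1 * w $ 4 - w $ 2 * w $ 3 - 1, w $ 3, w $ 1 + w $ 4 - t]" for w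
  \<comment> \<open>The trace gives the fourth entry; the determinant is then solved for the second,
    dividing by the third.\<close>
  define \<psi>0 :: "complex^4 \<Rightarrow> complex^4"
    where "\<psi>0 v = vector [v $ 1, (v $ 1 * (v $ 4 + t - v $ 1) - 1 - v $ 2) / v $ 3, v $ 3,
      v $ 4 + t - v $ 1]" for v
  define \<phi> where "\<phi> w = \<phi>0 (L w)" for w
  define \<psi> where "\<psi> v = L' (\<psi>0 v)" for v
  define V :: "(complex^4) set" where "V = {v. v $ 3 \<noteq> 0}"
  define U where "U = L -` V"
  have \<psi>\<phi>0: "\<psi>0 (\<phi>0 w) = w" if "w \<in> V" for w
    using that by (simp add: V_def \<phi>0_def \<psi>0_def vec_eq_iff forall_4 field_simps)
  have \<phi>\<psi>0: "\<phi>0 (\<psi>0 v) = v" if "v \<in> V" for v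
    using that by (simp add: V_def \<phi>0_def \<psi>0_def vec_eq_iff forall_4 field_simps)
  have V0: "\<phi>0 w \<in> V" "\<psi>0 w \<in> V" if "w \<in> V" for w
    using that by (auto simp: V_def \<phi>0_def \<psi>0_def)
  have "open V"
    unfolding V_def by (intro open_Collect_neq continuous_intros)
  moreover have "open U"
    unfolding U_def using \<open>open V\<close> holomorphic_map_on_imp_continuous_on[OF L] by (rule open_vimage)
  moreover have "p \<in> U" using p by (simp add: U_def V_def)
  moreover have h\<phi>: "holomorphic_map_on \<phi> U"
    unfolding \<phi>_def
  proof (rule holomorphic_map_on_compose[where f = L and V = UNIV])
    show "holomorphic_map_on L U" using L by (simp add: holomorphic_map_on_def)
    show "holomorphic_map_on \<phi>0 UNIV"
      unfolding \<phi>0_def by (intro holomorphic_map_on_vector4 holomorphic_at_intros)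
  qed simp
  moreover have h\<psi>: "holomorphic_map_on \<psi> V"
    unfolding \<psi>_def
  proof (rule holomorphic_map_on_compose[OF _ L'])
    show "holomorphic_map_on \<psi>0 V"
      unfolding \<psi>0_def
      by (intro holomorphic_map_on_vector4 holomorphic_at_intros) (simp add: V_def)
  qed simp
  moreover have "homeomorphism U V \<phi> \<psi>"
  proof
    show "continuous_on U \<phi>" "continuous_on V \<psi>"
      using h\<phi> h\<psi> by (auto intro: holomorphic_map_on_imp_continuous_on)
  qed (auto simp: \<phi>_def \<psi>_def U_def V0 \<psi>\<phi>0 \<phi>\<psi>0 inv)
  moreover have "card {1, 3 :: 4} = 2" by simp
  moreover have "\<phi> ` (flatten ` X_tilde t \<inter> U) = {w \<in> V. \<forall>i. i \<notin> {1, 3} \<longrightarrow> w $ i = 0}"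
  proof (intro equalityI subsetI)
    fix v assume "v \<in> \<phi> ` (flatten ` X_tilde t \<inter> U)"
    then obtain w where w: "w \<in> flatten ` X_tilde t" "L w \<in> V" "v = \<phi>0 (L w)"
      by (auto simp: \<phi>_def U_def)
    then show "v \<in> {w \<in> V. \<forall>i. i \<notin> {1, 3} \<longrightarrow> w $ i = 0}"
      using V0(1)[of "L w"] by (simp add: forall_4 \<phi>0_def tr det in_flatten_X_tilde_iff)
  next
    fix v assume "v \<in> {w \<in> V. \<forall>i. i \<notin> {1, 3} \<longrightarrow> w $ i = 0}"
    then have v: "v \<in> V" "v $ 2 = 0" "v $ 4 = 0" by auto
    define w where "w = \<psi> v"
    have Lw: "L w = \<psi>0 v" by (simp add: w_def \<psi>_def inv)
    have "w \<in> flatten ` X_tilde t"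
      unfolding in_flatten_X_tilde_iff tr[of w, symmetric] det[of w, symmetric]
    proof (intro conjI)
      show "L w $ 1 * L w $ 4 - L w $ 2 * L w $ 3 = 1" "L w $ 1 + L w $ 4 = t"
        using v by (simp_all add: Lw \<psi>0_def V_def)
      \<comment> \<open>For \<open>t = 2\<close> and \<open>t = -2\<close> one scalar matrix
        satisfies both equations too; the non-zero third coordinate of \<open>L w\<close> excludes
        it.\<close>
      show "w $ 2 \<noteq> 0 \<or> w $ 3 \<noteq> 0 \<or> w $ 1 \<noteq> w $ 4"
        using v by (intro nonscalar) (simp add: Lw \<psi>0_def V_def)
    qed
    moreover have "w \<in> U" "\<phi> w = v"
      using v(1) by (simp_all add: U_def \<phi>_def Lw V0 \<phi>\<psi>0)
    ultimately show "v \<in> \<phi> ` (flatten ` X_tilde t \<inter> U)" by blast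
  qed
  ultimately show ?thesis
    by (intro exI[of _ U] exI[of _ V] exI[of _ \<phi>] exI[of _ \<psi>] exI[of _ "{1, 3}"] conjI)
qed

text \<open>A non-scalar matrix gets a non-zero lower left entry at once, after transposition, or,
  if diagonal, after conjugation by a shear, which puts \<open>d - a\<close> there. All of these
  preserve trace and determinant.\<close>

lemma complex_submanifold_X_tilde: "complex_submanifold 2 (flatten ` X_tilde t)"
  unfolding complex_submanifold_def
proof
  fix p assume p: "p \<in> flatten ` X_tilde t"
  note holo = holomorphic_map_on_vector4 holomorphic_at_intros
  consider "p $ 3 \<noteq> 0" | "p $ 2 \<noteq> 0" | "p $ 2 = 0" "p $ 3 = 0" "p $ 1 \<noteq> p $ 4"
    using p by (auto simp: in_flatten_X_tilde_iff)
  then show "\<exists>U V (\<phi> :: complex^4 \<Rightarrow> complex^4) \<psi> J.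
      open U \<and> p \<in> U \<and> open V \<and>
      homeomorphism U V \<phi> \<psi> \<and> holomorphic_map_on \<phi> U \<and> holomorphic_map_on \<psi> V \<and>
      card J = 2 \<and> \<phi> ` (flatten ` X_tilde t \<inter> U) = {w \<in> V. \<forall>i. i \<notin> J \<longrightarrow> w $ i = 0}"
  proof cases
    case 1
    let ?L = "\<lambda>w :: complex^4. vector [w $ 1, w $ 2, w $ 3, w $ 4] :: complex^4"
    have "holomorphic_map_on ?L UNIV" by (intro holo)
    then show ?thesis
      using 1 by (intro X_tilde_chart[of ?L ?L]) (simp_all add: vec_eq_iff forall_4)
  next
    case 2
    let ?L = "\<lambda>w :: complex^4. vector [w $ 1, w $ 3, w $ 2, w $ 4] :: complex^4"
    have "holomorphic_map_on ?L UNIV" by (intro holo)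
    then show ?thesis
      using 2 by (intro X_tilde_chart[of ?L ?L]) (simp_all add: vec_eq_iff forall_4)
  next
    case 3
    \<comment> \<open>conjugation by \<open>mat22 1 0 1 1\<close>\<close>
    let ?L = "\<lambda>w :: complex^4. vector [w $ 1 + w $ 2, w $ 2, w $ 3 + w $ 4 - w $ 1 - w $ 2,
      w $ 4 - w $ 2] :: complex^4"
    let ?L' = "\<lambda>w :: complex^4. vector [w $ 1 - w $ 2, w $ 2, w $ 3 + w $ 1 - w $ 2 - w $ 4,
      w $ 4 + w $ 2] :: complex^4"
    have "holomorphic_map_on ?L UNIV" "holomorphic_map_on ?L' UNIV" by (intro holo)+
    then show ?thesis
      using 3 by (intro X_tilde_chart[of ?L ?L'])
        (auto simp: vec_eq_iff forall_4 algebra_simps)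
  qed
qed


subsection \<open>The decomposition\<close>

text \<open>Quantifying over every admissible \<open>lam\<close> covers either choice of the sign of
  the angle.\<close>

theorem theorem4p8:
  fixes lam :: "complex \<Rightarrow> complex"
  assumes lam: "\<And>t. is_lambda t (lam t)"
  shows "quandle_components (Conj SL2) = {{mat 1}, {- mat 1}} \<union> range X_tilde
    \<and> carrier SL2 = {mat 1} \<union> {- mat 1} \<union> (\<Union>t. X_tilde t)
    \<and> (mat 1 :: complex^2^2) \<noteq> - mat 1
    \<and> {mat 1, - mat 1} \<inter> (\<Union>t. X_tilde t) = {}
    \<and> disjoint_family X_tilde
    \<and> (\<forall>t. complex_submanifold 2 (flatten ` X_tilde t)
        \<and> subtopology SL2_topology (X_tilde t) homeomorphic_space
            quotient_topology SL2_topology (\<lambda>g. H_tilde t #>\<^bsub>SL2\<^esub> g)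
        \<and> subquandle (X_tilde t) (Conj SL2)
        \<and> connected_quandle (Conj_on SL2 (X_tilde t))
        \<and> quandle_triplet SL2 (H_tilde t) (sigma_tilde t (lam t))
        \<and> quandle_isomorphic (Conj_on SL2 (X_tilde t))
            (Q SL2 (H_tilde t) (sigma_tilde t (lam t))))"
proof -
  have center: "(mat 1 :: complex^2^2) \<noteq> - mat 1"
    by (simp add: mat_1_eq_mat22 minus_mat22 mat22_eq_iff)
  have disj: "{mat 1, - mat 1} \<inter> (\<Union>t. X_tilde t) = {}" "disjoint_family X_tilde"
    by (auto simp: X_tilde_def disjoint_family_on_def)
  have cosets: "subtopology SL2_topology (X_tilde t) homeomorphic_space
        quotient_topology SL2_topology (\<lambda>g. H_tilde t #>\<^bsub>SL2\<^esub> g)"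
      "quandle_triplet SL2 (H_tilde t) (sigma_tilde t (lam t))"
      "quandle_isomorphic (Conj_on SL2 (X_tilde t)) (Q SL2 (H_tilde t) (sigma_tilde t (lam t)))" for t
  proof -
    define A where "A = A_mat t (lam t)"
    have A: "A \<in> X_tilde t" "A \<in> carrier SL2"
      using A_mat_in_X_tilde[OF lam] X_tilde_subset_SL2 by (auto simp: A_def)
    have H: "H_tilde t = {h \<in> carrier SL2. h \<otimes>\<^bsub>SL2\<^esub> A = A \<otimes>\<^bsub>SL2\<^esub> h}"
      using H_tilde_eq_centralizer[OF lam] by (simp add: A_def)
    have \<sigma>: "sigma_tilde t (lam t) = (\<lambda>g. inv\<^bsub>SL2\<^esub> A \<otimes>\<^bsub>SL2\<^esub> g \<otimes>\<^bsub>SL2\<^esub> A)"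
      by (simp add: sigma_tilde_def A_def fun_eq_iff)
    show "quandle_triplet SL2 (H_tilde t) (sigma_tilde t (lam t))"
      unfolding \<sigma> by (rule SL2.quandle_triplet_centralizer[OF A(2) H])
    show "quandle_isomorphic (Conj_on SL2 (X_tilde t)) (Q SL2 (H_tilde t) (sigma_tilde t (lam t)))"
      unfolding \<sigma> using X_tilde_eq_conjugates[OF A(1)]
      by (intro SL2.conjugacy_class_isomorphic_Q[OF A(2) H]) simp
    have "subtopology SL2_topology (X_tilde t) = top_of_set (X_tilde t)"
      by (simp add: SL2_topology_eq subtopology_subtopology Int_absorb1 X_tilde_subset_SL2)
    \<comment> \<open>Conjugating \<open>A\<close> and projecting to cosets are quotient maps on the
      same group with the same fibres.\<close>
    moreover have "top_of_set (X_tilde t) homeomorphic_space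
        quotient_topology (top_of_set (carrier SL2)) (\<lambda>g. H_tilde t #>\<^bsub>SL2\<^esub> g)"
      by (rule quotient_maps_same_fibres_imp_homeomorphic[OF quotient_map_conjugation[OF A(1)]
          quotient_map_quotient_topology]) (use SL2.conj_eq_iff_same_coset[OF A(2) H] in simp)
    ultimately show "subtopology SL2_topology (X_tilde t) homeomorphic_space
        quotient_topology SL2_topology (\<lambda>g. H_tilde t #>\<^bsub>SL2\<^esub> g)"
      by (simp only: SL2_topology_eq)
  qed
  show ?thesis
    by (intro conjI allI quandle_components_Conj_SL2 SL2_eq_center_Un_X_tilde center disj cosets
        complex_submanifold_X_tilde subquandle_X_tilde connected_Conj_X_tilde)
qed

end
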